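(* Let $\lambda,\mu,\nu,\kappa>0$ and put $\theta=\lambda/\nu$, $\gamma=\kappa/\nu$, $\eta=\mu/\nu$, $A_k=\int_0^1\gamma(1-t)^{\gamma-1}t^{\eta-1+k}e^{-\theta t}\,dt$. Let $\pi$ be the stationary distribution of the M/M/1+M queue with random resetting (see context), and let $P_{\mathrm{delay}}=\sum_{k\ge1}\pi_k$, $L_{\mathrm{system}}=\sum_{k\ge0}k\pi_k$, $L_{\mathrm{queue}}=\sum_{k\ge1}(k-1)\pi_k$, and let $\mathbb{E}[W]$ and $\mathbb{E}[V]$ be the expected actual and virtual waiting times. Then $$\pi_0=\frac{\gamma A_0}{(\gamma+\theta)A_0-\theta A_1},\qquad P_{\mathrm{delay}}=1-\pi_0,$$ $$L_{\mathrm{system}}=\frac{\eta-1}{\gamma+1}\pi_0+\frac{\theta-\eta+1}{\gamma+1},\qquad L_{\mathrm{queue}}=\frac{\gamma+\eta}{\gamma+1}\pi_0+\frac{\theta-\eta-\gamma}{\gamma+1},$$ $$\mathbb{E}[W]=\frac1\lambda\left(\frac{\gamma+\eta}{\gamma+1}\pi_0+\frac{\theta-\eta-\gamma}{\gamma+1}\right),$$ $$\mathbb{E}[V]=\frac1\nu\cdot\frac{\theta\gamma}{(\gamma+\theta)A_0-\theta A_1}\int_0^1\gamma(1-t)^{\gamma-1}\int_0^t s^{-1}\int_0^s u^{\eta-1}e^{-\theta u}\,du\,ds\,dt.$$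
   Context: The M/M/1+M queue with random resetting (first-come first-served) is the continuous-time Markov chain on $\mathbb{Z}_+$ with transition mechanisms: $i\to i+1$ at rate $\lambda$ ($i\ge0$, arrival); $i\to i-1$ at rate $\mu+(i-1)\nu$ ($i\ge1$, departure by service or abandonment); $i\to0$ at rate $\kappa$ ($i\ge1$, resetting); it has a unique stationary distribution $\pi$. A customer arriving at the stationary system finds $n$ customers with probability $\pi_n$. The virtual waiting time $V$ (the waiting time if the customer does not abandon and no resetting occurs while waiting) is $0$ if $n=0$ and, given $n\ge1$, is distributed as $Z_1+\cdots+Z_n$ with $Z_j$ independent exponential of rate $\mu+(j-1)\nu$. The actual waiting time $W$ is the time the customer spends waiting in the queue until service starts, it abandons, or a resetting occurs, i.e. $W=\min(V,A,R)$ with $A$ exponential of rate $\nu$ (patience) and $R$ exponential of rate $\kappa$ (time to resetting), with $V,A,R$ independent given $n$. *)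

theory Defs
  imports "HOL-Probability.Probability"
begin

text \<open>Standard (stochastic) transition functions on the state space \<open>nat\<close> with Q-matrix \<open>Q\<close>,
  i.e. the transition probabilities of a continuous-time Markov chain with jump rates \<open>Q i j\<close>.\<close>

definition transition_function ::
    "(nat \<Rightarrow> nat \<Rightarrow> real) \<Rightarrow> (real \<Rightarrow> nat \<Rightarrow> nat \<Rightarrow> real) \<Rightarrow> bool" where
  "transition_function Q P \<longleftrightarrow>
     (\<forall>t\<ge>0. \<forall>i j. 0 \<le> P t i j) \<and>
     (\<forall>t\<ge>0. \<forall>i. ((\<lambda>j. P t i j) has_sum 1) UNIV) \<and>
     (\<forall>i j. P 0 i j = (if i = j then 1 else 0)) \<and>
     (\<forall>s\<ge>0. \<forall>t\<ge>0. \<forall>i j. ((\<lambda>k. P s i k * P t k j) has_sum P (s + t) i j) UNIV) \<and>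
     (\<forall>i j. ((\<lambda>t. P t i j) has_real_derivative Q i j) (at 0 within {0..}))"

definition stationary_distribution ::
    "(real \<Rightarrow> nat \<Rightarrow> nat \<Rightarrow> real) \<Rightarrow> (nat \<Rightarrow> real) \<Rightarrow> bool" where
  "stationary_distribution P \<pi> \<longleftrightarrow>
     (\<forall>i. 0 \<le> \<pi> i) \<and> (\<pi> has_sum 1) UNIV \<and>
     (\<forall>t\<ge>0. \<forall>j. ((\<lambda>i. \<pi> i * P t i j) has_sum \<pi> j) UNIV)"

text \<open>The three mechanisms are added up: from state 1 both a departure and a resetting lead
  to 0, so that transition has rate \<open>\<mu> + \<kappa>\<close>.\<close>

definition queue_rate :: "real \<Rightarrow> real \<Rightarrow> real \<Rightarrow> real \<Rightarrow> nat \<Rightarrow> nat \<Rightarrow> real" where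
  "queue_rate lam \<mu> \<nu> \<kappa> i j =
     (if j = i + 1 then lam else 0) +
     (if i \<ge> 1 \<and> j = i - 1 then \<mu> + (real i - 1) * \<nu> else 0) +
     (if i \<ge> 1 \<and> j = 0 then \<kappa> else 0)"

definition queue_generator :: "real \<Rightarrow> real \<Rightarrow> real \<Rightarrow> real \<Rightarrow> nat \<Rightarrow> nat \<Rightarrow> real" where
  "queue_generator lam \<mu> \<nu> \<kappa> i j =
     (if i = j then - (\<Sum>k\<in>{0..i + 1} - {i}. queue_rate lam \<mu> \<nu> \<kappa> i k)
      else queue_rate lam \<mu> \<nu> \<kappa> i j)"

definition exponential_law :: "real \<Rightarrow> real measure" where
  "exponential_law r = density lborel (\<lambda>x. ennreal (exponential_density r x))"

text \<open>The law of \<open>Z\<^sub>1 + \<dots> + Z\<^sub>n\<close> for independent exponential \<open>Z\<^sub>j\<close> of rate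
  \<open>\<mu> + (j - 1) \<nu>\<close>; for \<open>n = 0\<close> it is the point mass at 0.\<close>

definition virtual_waiting_law :: "real \<Rightarrow> real \<Rightarrow> nat \<Rightarrow> real measure" where
  "virtual_waiting_law \<mu> \<nu> n =
     distr (PiM {1..n} (\<lambda>j. exponential_law (\<mu> + (real j - 1) * \<nu>))) borel
       (\<lambda>z. \<Sum>j\<in>{1..n}. z j)"

text \<open>\<open>N\<close> is the number of customers found on arrival, \<open>V\<close> the virtual waiting time, \<open>A\<close> the
  patience and \<open>R\<close> the time to resetting. Conditionally on \<open>N = n\<close>, the joint law of
  \<open>(V, A, R)\<close> is a product, which is conditional independence.\<close>

definition arriving_customer ::
    "real \<Rightarrow> real \<Rightarrow> real \<Rightarrow> (nat \<Rightarrow> real) \<Rightarrow> 'w measure \<Rightarrow>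
     ('w \<Rightarrow> nat) \<Rightarrow> ('w \<Rightarrow> real) \<Rightarrow> ('w \<Rightarrow> real) \<Rightarrow> ('w \<Rightarrow> real) \<Rightarrow> bool" where
  "arriving_customer \<mu> \<nu> \<kappa> \<pi> M N V A R \<longleftrightarrow>
     prob_space M \<and>
     N \<in> M \<rightarrow>\<^sub>M count_space UNIV \<and>
     V \<in> borel_measurable M \<and> A \<in> borel_measurable M \<and> R \<in> borel_measurable M \<and>
     (\<forall>n. measure M {\<omega> \<in> space M. N \<omega> = n} = \<pi> n) \<and>
     (\<forall>n. \<pi> n > 0 \<longrightarrow>
        distr (uniform_measure M {\<omega> \<in> space M. N \<omega> = n}) (borel \<Otimes>\<^sub>M (borel \<Otimes>\<^sub>M borel))
          (\<lambda>\<omega>. (V \<omega>, A \<omega>, R \<omega>)) =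
        virtual_waiting_law \<mu> \<nu> n \<Otimes>\<^sub>M (exponential_law \<nu> \<Otimes>\<^sub>M exponential_law \<kappa>))"

definition actual_waiting_time ::
    "('w \<Rightarrow> real) \<Rightarrow> ('w \<Rightarrow> real) \<Rightarrow> ('w \<Rightarrow> real) \<Rightarrow> 'w \<Rightarrow> real" where
  "actual_waiting_time V A R \<omega> = min (V \<omega>) (min (A \<omega>) (R \<omega>))"

definition A_integral :: "real \<Rightarrow> real \<Rightarrow> real \<Rightarrow> nat \<Rightarrow> real" where
  "A_integral \<theta> \<gamma> \<eta> k =
     (LBINT t:{0..1}. \<gamma> * (1 - t) powr (\<gamma> - 1) * t powr (\<eta> - 1 + real k) * exp (- \<theta> * t))"

end

theory Submission imports Defs begin

text \<open>
  A stationary distribution balances the probability flow between \<open>{0..n}\<close> and its complement.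
  In units of \<open>\<nu>\<close> this reads \<open>\<theta> \<pi>\<^sub>n = (\<eta> + n) \<pi>\<^sub>n\<^sub>+\<^sub>1 + \<gamma> T\<^sub>n\<close>, where \<open>T\<^sub>n\<close> is the tail
  \<open>\<pi>\<^sub>n\<^sub>+\<^sub>1 + \<pi>\<^sub>n\<^sub>+\<^sub>2 + \<dots>\<close>. To derive it from \<open>\<pi> P\<^sub>t = \<pi>\<close>, let \<open>t\<close> tend to 0 in the flow identity
  at time \<open>t\<close>: the outflow is a finite sum, so each single inflow term is bounded in the limit,
  which gives a finite first moment of \<open>\<pi>\<close>, and this in turn dominates the whole inflow.

  Up to a factor the equations have a single summable solution, because a positive \<open>T\<^sub>0\<close> with
  \<open>\<pi>\<^sub>0 = 0\<close> would make the tails increase. Integration by parts shows that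
  \<open>\<theta>\<^sup>n A\<^sub>n / (\<eta> (\<eta> + 1) \<dots> (\<eta> + n - 1))\<close> is a solution whose tails are explicit, and
  normalising it gives \<open>\<pi>\<^sub>0\<close>.

  Summing the balance equations against test sequences yields the means: the constant sequence
  gives the queue lengths, and \<open>n \<mapsto> 1 - E exp (- (\<nu> + \<kappa>) V\<^sub>n)\<close>, with \<open>V\<^sub>n\<close> the virtual waiting time
  behind \<open>n\<close> customers, gives the actual waiting time. Finally
  \<open>E V = \<Sum>\<^sub>j T\<^sub>j / (\<mu> + j \<nu>)\<close>, which is the term-by-term value of the iterated integral when
  the incomplete gamma integral is expanded into its series.
\<close>

section \<open>Exponentially tilted beta and lower incomplete gamma integrals\<close>

text \<open>For nonnegative functions the gauge and the Lebesgue integral agree, so values obtained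
  from antiderivatives become available for \<open>LBINT\<close>.\<close>

lemma set_integral_eq_has_integral_nonneg:
  fixes f :: "real \<Rightarrow> real"
  assumes "(f has_integral r) S" "f \<in> borel_measurable borel" "S \<in> sets borel"
    "\<And>x. x \<in> S \<Longrightarrow> 0 \<le> f x"
  shows "set_integrable lborel S f" "(LBINT x:S. f x) = r"
proof -
  have [measurable]: "f \<in> borel_measurable borel" "S \<in> sets borel"
    using assms by auto
  have r: "0 \<le> r"
    using assms(1,4) by (rule has_integral_nonneg)
  have "has_bochner_integral lborel (\<lambda>x. indicator S x * f x) r"
  proof (rule has_bochner_integral_nn_integral[OF _ _ r])
    show "(\<integral>\<^sup>+ x. ennreal (indicator S x * f x) \<partial>lborel) = ennreal r"
      using assms by (intro nn_integral_has_integral_lebesgue) auto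
  qed (use assms(4) in \<open>auto simp: indicator_def\<close>)
  then show "set_integrable lborel S f" "(LBINT x:S. f x) = r"
    by (auto simp: set_integrable_def set_lebesgue_integral_def has_bochner_integral_iff)
qed

text \<open>Nonnegative terms are their own norms, so summable integrals are all that
  \<open>sums_integral\<close> asks for. In this form the incomplete gamma series is integrated
  twice term by term.\<close>

lemma set_integral_sums_nonneg:
  fixes f :: "nat \<Rightarrow> 'a \<Rightarrow> real"
  assumes int: "\<And>j. set_integrable M S (f j)"
    and nonneg: "\<And>j x. x \<in> S \<Longrightarrow> 0 \<le> f j x"
    and sums: "\<And>x. x \<in> S \<Longrightarrow> (\<lambda>j. f j x) sums g x"
    and summ: "summable (\<lambda>j. LINT x:S|M. f j x)"
  shows "(\<lambda>j. LINT x:S|M. f j x) sums (LINT x:S|M. g x)"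
proof -
  let ?f = "\<lambda>j x. indicator S x *\<^sub>R f j x"
  have norm: "norm (?f j x) = ?f j x" for j x
    using nonneg by (auto simp: indicator_def)
  have s: "(\<lambda>j. ?f j x) sums (indicator S x *\<^sub>R g x)" for x
    using sums by (cases "x \<in> S") auto
  have "(\<lambda>j. LINT x|M. ?f j x) sums (LINT x|M. (\<Sum>j. ?f j x))"
  proof (rule sums_integral)
    show "integrable M (?f j)" for j
      using int by (simp add: set_integrable_def)
    show "AE x in M. summable (\<lambda>j. norm (?f j x))"
      unfolding norm using s by (intro AE_I2) (rule sums_summable)
    show "summable (\<lambda>j. LINT x|M. norm (?f j x))"
      unfolding norm using summ by (simp add: set_lebesgue_integral_def)
  qed
  also have "(\<lambda>x. \<Sum>j. ?f j x) = (\<lambda>x. indicator S x *\<^sub>R g x)"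
    by (intro ext sums_unique[symmetric] s)
  finally show ?thesis
    by (simp add: set_lebesgue_integral_def)
qed

text \<open>Substituting \<open>v = \<theta> * u\<close> gives, for positive \<theta>,
  \<open>\<theta> powr (- a)\<close> times the classical lower incomplete gamma function at
  \<open>a\<close> and \<open>\<theta> * s\<close>.\<close>

definition lower_gamma :: "real \<Rightarrow> real \<Rightarrow> real \<Rightarrow> real" where
  "lower_gamma \<theta> a s = (LBINT u:{0..s}. u powr (a - 1) * exp (- \<theta> * u))"

text \<open>Up to the factor \<open>Beta a c\<close> this is Kummer's confluent hypergeometric
  function with parameters \<open>a\<close> and \<open>a + c\<close> at \<open>- \<theta>\<close>.
  The exponent \<open>c\<close> is kept free because probabilities use \<open>\<gamma>\<close> and
  tails use \<open>\<gamma> + 1\<close>.\<close>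

definition tilted_beta :: "real \<Rightarrow> real \<Rightarrow> real \<Rightarrow> real" where
  "tilted_beta \<theta> a c =
     (LBINT t:{0..1}. (1 - t) powr (c - 1) * t powr (a - 1) * exp (- \<theta> * t))"

lemma lower_gamma_integrable:
  fixes a \<theta> :: real
  assumes "0 < a" "0 \<le> s" "0 \<le> \<theta>"
  shows "set_integrable lborel {0..s} (\<lambda>u. u powr (a - 1) * exp (- \<theta> * u))"
proof (rule set_integrable_bound)
  have "((\<lambda>x::real. x powr (a - 1)) has_integral (s powr (a - 1 + 1) / (a - 1 + 1))) {0..s}"
    using assms by (intro has_integral_powr_from_0) auto
  then show "set_integrable lborel {0..s} (\<lambda>u. u powr (a - 1))"
    by (intro set_integral_eq_has_integral_nonneg) auto
  show "set_borel_measurable lborel {0..s} (\<lambda>u. u powr (a - 1) * exp (- \<theta> * u))"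
    unfolding set_borel_measurable_def by measurable
  show "AE x in lborel. x \<in> {0..s} \<longrightarrow>
      norm (x powr (a - 1) * exp (- \<theta> * x)) \<le> norm (x powr (a - 1))"
    using assms by (auto intro!: AE_I2 mult_left_le)
qed

lemma tilted_beta_integrable:
  fixes a \<theta> :: real
  assumes "0 < a" "0 < c" "0 \<le> \<theta>"
  shows "set_integrable lborel {0..1} (\<lambda>t. (1 - t) powr (c - 1) * t powr (a - 1) * exp (- \<theta> * t))"
proof (rule set_integrable_bound)
  show "set_integrable lborel {0..1} (\<lambda>t. t powr (a - 1) * (1 - t) powr (c - 1))"
    using assms by (intro integrable_Beta)
  show "set_borel_measurable lborel {0..1}
      (\<lambda>t. (1 - t) powr (c - 1) * t powr (a - 1) * exp (- \<theta> * t))"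
    unfolding set_borel_measurable_def by measurable
  show "AE x in lborel. x \<in> {0..1} \<longrightarrow>
      norm ((1 - x) powr (c - 1) * x powr (a - 1) * exp (- \<theta> * x))
      \<le> norm (x powr (a - 1) * (1 - x) powr (c - 1))"
  proof (intro AE_I2 impI)
    fix x :: real assume x: "x \<in> {0..1}"
    then have "exp (- \<theta> * x) \<le> 1"
      using assms by simp
    then have "x powr (a - 1) * (1 - x) powr (c - 1) * exp (- \<theta> * x)
        \<le> x powr (a - 1) * (1 - x) powr (c - 1)"
      by (intro mult_left_le) auto
    then show "norm ((1 - x) powr (c - 1) * x powr (a - 1) * exp (- \<theta> * x))
      \<le> norm (x powr (a - 1) * (1 - x) powr (c - 1))"
      by (simp add: abs_mult mult_ac)
  qed
qed

lemma lower_gamma_nonneg: "0 \<le> lower_gamma \<theta> a s"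
  unfolding lower_gamma_def set_lebesgue_integral_def
  by (rule Bochner_Integration.integral_nonneg) (auto simp: indicator_def)

lemma tilted_beta_nonneg: "0 \<le> tilted_beta \<theta> a c"
  unfolding tilted_beta_def set_lebesgue_integral_def
  by (rule Bochner_Integration.integral_nonneg) (auto simp: indicator_def)

lemma tilted_beta_antimono:
  assumes "0 < a" "a \<le> b" "0 < c" "0 \<le> \<theta>"
  shows "tilted_beta \<theta> b c \<le> tilted_beta \<theta> a c"
  unfolding tilted_beta_def
proof (rule set_integral_mono)
  fix t :: real assume t: "t \<in> {0..1}"
  show "(1 - t) powr (c - 1) * t powr (b - 1) * exp (- \<theta> * t)
      \<le> (1 - t) powr (c - 1) * t powr (a - 1) * exp (- \<theta> * t)"
    using assms t by (intro mult_right_mono mult_left_mono powr_mono') auto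
qed (use assms in \<open>(intro tilted_beta_integrable; simp)+\<close>)

lemma lower_gamma_antimono:
  assumes "0 < a" "a \<le> b" "0 \<le> \<theta>" "0 \<le> s" "s \<le> 1"
  shows "lower_gamma \<theta> b s \<le> lower_gamma \<theta> a s"
  unfolding lower_gamma_def
proof (rule set_integral_mono)
  fix t :: real assume t: "t \<in> {0..s}"
  show "t powr (b - 1) * exp (- \<theta> * t) \<le> t powr (a - 1) * exp (- \<theta> * t)"
    using assms t by (intro mult_right_mono powr_mono') auto
qed (use assms in \<open>(intro lower_gamma_integrable; simp)+\<close>)

lemma tilted_beta_pos:
  assumes "0 < a" "0 < c" "0 \<le> \<theta>"
  shows "0 < tilted_beta \<theta> a c"
proof (rule ccontr)
  let ?f = "\<lambda>t. indicator {0..1} t *\<^sub>R ((1 - t) powr (c - 1) * t powr (a - 1) * exp (- \<theta> * t))"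
  assume "\<not> ?thesis"
  then have "(LBINT t. ?f t) = 0"
    using tilted_beta_nonneg[of \<theta> a c] unfolding tilted_beta_def set_lebesgue_integral_def by linarith
  moreover have "integrable lborel ?f"
    using tilted_beta_integrable[OF assms] by (simp add: set_integrable_def)
  ultimately have "AE t in lborel. ?f t = 0"
    by (subst (asm) integral_nonneg_eq_0_iff_AE) (auto simp: indicator_def)
  \<comment> \<open>Inside the unit interval the integrand is strictly positive; the endpoints drop
    out because \<open>0 powr x = 0\<close>.\<close>
  then have "AE t in lborel. t \<notin> {0<..<1::real}"
    by eventually_elim auto
  then have "emeasure lborel {0<..<1::real} = 0"
    by (subst (asm) AE_iff_measurable[of "{0<..<1::real}"]) auto
  then show False by simp
qed

text \<open>The additional factor \<open>1 - t\<close> in the integrand is expanded.\<close>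

lemma tilted_beta_split:
  assumes "0 < a" "0 < c" "0 \<le> \<theta>"
  shows "tilted_beta \<theta> a (c + 1) = tilted_beta \<theta> a c - tilted_beta \<theta> (a + 1) c"
proof -
  have "tilted_beta \<theta> a c - tilted_beta \<theta> (a + 1) c = (LBINT t:{0..1}.
      (1 - t) powr (c - 1) * t powr (a - 1) * exp (- \<theta> * t) -
      (1 - t) powr (c - 1) * t powr (a + 1 - 1) * exp (- \<theta> * t))"
    unfolding tilted_beta_def using assms
    by (intro set_integral_diff(2)[symmetric] tilted_beta_integrable) auto
  also have "\<dots> = tilted_beta \<theta> a (c + 1)"
    unfolding tilted_beta_def
  proof (rule set_lebesgue_integral_cong_AE)
    show "AE t\<in>{0..1} in lborel. (1 - t) powr (c - 1) * t powr (a - 1) * exp (- \<theta> * t) -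
      (1 - t) powr (c - 1) * t powr (a + 1 - 1) * exp (- \<theta> * t) =
      (1 - t) powr (c + 1 - 1) * t powr (a - 1) * exp (- \<theta> * t)"
    proof (rule AE_I2, rule impI)
      fix t :: real assume t: "t \<in> {0..1}"
      have 1: "t powr (a + 1 - 1) = t powr (a - 1) * t"
        using t powr_mult_base[of t "a - 1"] by (simp add: mult.commute)
      have 2: "(1 - t) powr (c + 1 - 1) = (1 - t) powr (c - 1) * (1 - t)"
        using t powr_mult_base[of "1 - t" "c - 1"] by (simp add: mult.commute)
      show "(1 - t) powr (c - 1) * t powr (a - 1) * exp (- \<theta> * t) -
        (1 - t) powr (c - 1) * t powr (a + 1 - 1) * exp (- \<theta> * t) =
        (1 - t) powr (c + 1 - 1) * t powr (a - 1) * exp (- \<theta> * t)"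
        unfolding 1 2 by (simp add: algebra_simps)
    qed
  qed auto
  finally show ?thesis by simp
qed

lemma lower_gamma_has_integral:
  assumes "0 < a" "0 \<le> s" "0 \<le> \<theta>"
  shows "((\<lambda>u. u powr (a - 1) * exp (- \<theta> * u)) has_integral lower_gamma \<theta> a s) {0..s}"
  unfolding lower_gamma_def set_borel_integral_eq_integral(2)[OF lower_gamma_integrable[OF assms]]
  by (intro integrable_integral set_borel_integral_eq_integral(1) lower_gamma_integrable assms)

lemma tilted_beta_has_integral:
  assumes "0 < a" "0 < c" "0 \<le> \<theta>"
  shows "((\<lambda>t. (1 - t) powr (c - 1) * t powr (a - 1) * exp (- \<theta> * t)) has_integral
           tilted_beta \<theta> a c) {0..1}"
  unfolding tilted_beta_def set_borel_integral_eq_integral(2)[OF tilted_beta_integrable[OF assms]]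
  by (intro integrable_integral set_borel_integral_eq_integral(1) tilted_beta_integrable assms)

text \<open>Integrate the derivative of \<open>u powr a * exp (- \<theta> * u)\<close>. For
  \<open>a < 1\<close> it is unbounded at 0, hence the interior form of the fundamental
  theorem.\<close>

lemma lower_gamma_rec:
  assumes "0 < a" "0 \<le> s" "0 \<le> \<theta>"
  shows "a * lower_gamma \<theta> a s = s powr a * exp (- \<theta> * s) + \<theta> * lower_gamma \<theta> (a + 1) s"
proof -
  let ?F = "\<lambda>u. u powr a * exp (- \<theta> * u)"
  let ?f = "\<lambda>u. a * (u powr (a - 1) * exp (- \<theta> * u)) - \<theta> * (u powr (a + 1 - 1) * exp (- \<theta> * u))"
  have "(?f has_integral (?F s - ?F 0)) {0..s}"
  proof (rule fundamental_theorem_of_calculus_interior)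
    show "continuous_on {0..s} ?F"
      using assms by (intro continuous_intros continuous_on_powr') auto
    fix u assume "u \<in> {0<..<s}"
    then show "(?F has_vector_derivative ?f u) (at u)"
      unfolding has_real_derivative_iff_has_vector_derivative[symmetric]
      by (auto intro!: derivative_eq_intros simp: algebra_simps)
  qed (use assms in auto)
  moreover have "(?f has_integral (a * lower_gamma \<theta> a s - \<theta> * lower_gamma \<theta> (a + 1) s)) {0..s}"
    using assms
    by (intro has_integral_diff has_integral_mult_right lower_gamma_has_integral) auto
  ultimately have "?F s - ?F 0 = a * lower_gamma \<theta> a s - \<theta> * lower_gamma \<theta> (a + 1) s"
    by (rule has_integral_unique)
  then show ?thesis
    using assms by simp
qed

text \<open>The product rule for \<open>(1 - t) powr c * t powr a * exp (- \<theta> * t)\<close>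
  supplies the three terms; positivity of \<open>a\<close> and \<open>c\<close> makes both boundary
  values vanish.\<close>

lemma tilted_beta_rec:
  assumes "0 < a" "0 < c" "0 \<le> \<theta>"
  shows "a * tilted_beta \<theta> a (c + 1) =
    \<theta> * tilted_beta \<theta> (a + 1) (c + 1) + c * tilted_beta \<theta> (a + 1) c"
proof -
  let ?F = "\<lambda>t::real. (1 - t) powr c * t powr a * exp (- \<theta> * t)"
  let ?f = "\<lambda>t. a * ((1 - t) powr (c + 1 - 1) * t powr (a - 1) * exp (- \<theta> * t)) -
    \<theta> * ((1 - t) powr (c + 1 - 1) * t powr (a + 1 - 1) * exp (- \<theta> * t)) -
    c * ((1 - t) powr (c - 1) * t powr (a + 1 - 1) * exp (- \<theta> * t))"
  have "(?f has_integral (?F 1 - ?F 0)) {0..1}"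
  proof (rule fundamental_theorem_of_calculus_interior)
    show "continuous_on {0..1} ?F"
      using assms by (intro continuous_intros continuous_on_powr') auto
    fix u :: real assume "u \<in> {0<..<1}"
    then show "(?F has_vector_derivative ?f u) (at u)"
      unfolding has_real_derivative_iff_has_vector_derivative[symmetric]
      by (auto intro!: derivative_eq_intros simp: algebra_simps)
  qed auto
  moreover have "(?f has_integral (a * tilted_beta \<theta> a (c + 1) -
      \<theta> * tilted_beta \<theta> (a + 1) (c + 1) - c * tilted_beta \<theta> (a + 1) c)) {0..1}"
    using assms
    by (intro has_integral_diff has_integral_mult_right tilted_beta_has_integral) auto
  ultimately have "?F 1 - ?F 0 = a * tilted_beta \<theta> a (c + 1) -
      \<theta> * tilted_beta \<theta> (a + 1) (c + 1) - c * tilted_beta \<theta> (a + 1) c"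
    by (rule has_integral_unique)
  then show ?thesis
    using assms by simp
qed

text \<open>Integration by parts against the antiderivative \<open>- (1 - t)\<^sup>c\<close>.\<close>

lemma beta_weighted_lower_gamma:
  assumes "0 < a" "0 < c" "0 \<le> \<theta>"
  shows "set_integrable lborel {0..1} (\<lambda>t. c * (1 - t) powr (c - 1) * lower_gamma \<theta> a t)"
    and "(LBINT t:{0..1}. c * (1 - t) powr (c - 1) * lower_gamma \<theta> a t) = tilted_beta \<theta> a (c + 1)"
proof -
  let ?g = "\<lambda>u. u powr (a - 1) * exp (- \<theta> * u)"
  let ?I = "\<lambda>t. integral {0..t} ?g"
  have I: "?I t = lower_gamma \<theta> a t" if "0 \<le> t" for t
    using lower_gamma_has_integral[OF assms(1) that assms(3)] by (rule integral_unique)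
  have g: "?g integrable_on {0..1}"
    using lower_gamma_has_integral[of a 1 \<theta>] assms by auto
  have cont: "continuous_on {0..1} ?I"
    using g by (rule indefinite_integral_continuous_1)
  have deriv: "(?I has_real_derivative ?g t) (at t)" if t: "t \<in> {0<..<1}" for t
  proof -
    have "isCont ?g t"
      using t by (intro continuous_intros) auto
    then have "(?I has_vector_derivative ?g t) (at t within ({0..1} - {}))"
      using t by (intro integral_has_vector_derivative_continuous_at[OF g])
        (auto intro: continuous_at_imp_continuous_at_within)
    then show ?thesis
      using t at_within_interior[of t "{0..1}"]
      by (simp add: has_real_derivative_iff_has_vector_derivative interior_atLeastAtMost_real)
  qed
  let ?F = "\<lambda>t. - ((1 - t) powr c * ?I t)"
  let ?f = "\<lambda>t. c * (1 - t) powr (c - 1) * ?I t -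
    (1 - t) powr (c + 1 - 1) * t powr (a - 1) * exp (- \<theta> * t)"
  have "(?f has_integral (?F 1 - ?F 0)) {0..1}"
  proof (rule fundamental_theorem_of_calculus_interior)
    show "continuous_on {0..1} ?F"
      using assms by (intro continuous_intros continuous_on_powr' cont) auto
    fix u :: real assume u: "u \<in> {0<..<1}"
    have "((\<lambda>t. (1 - t) powr c) has_real_derivative - (c * (1 - u) powr (c - 1))) (at u)"
      using u by (auto intro!: derivative_eq_intros)
    from DERIV_minus[OF DERIV_mult[OF this deriv[OF u]]]
    show "(?F has_vector_derivative ?f u) (at u)"
      unfolding has_real_derivative_iff_has_vector_derivative[symmetric]
      by (rule DERIV_cong) (simp add: algebra_simps)
  qed auto
  \<comment> \<open>\<open>?F\<close> vanishes at 1 through the factor \<open>(1 - t) powr c\<close>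
    and at 0 because the inner integral is over a point.\<close>
  then have "(?f has_integral 0) {0..1}"
    by simp
  from has_integral_add[OF this tilted_beta_has_integral[of a "c + 1" \<theta>]]
  have J: "((\<lambda>t. c * (1 - t) powr (c - 1) * ?I t) has_integral tilted_beta \<theta> a (c + 1)) {0..1}"
    using assms by simp
  \<comment> \<open>\<open>?I\<close> is controlled only on the unit interval, where it is
    continuous; the cutoff makes the integrand Borel measurable and nonnegative everywhere.\<close>
  let ?h = "\<lambda>t. indicator {0..1} t * (c * (1 - t) powr (c - 1) * ?I t)"
  have I_meas: "(\<lambda>t. indicator {0..1} t *\<^sub>R ?I t) \<in> borel_measurable borel"
    using cont by (intro borel_measurable_continuous_on_indicator) auto
  have "(\<lambda>t. (c * (1 - t) powr (c - 1)) * (indicator {0..1} t *\<^sub>R ?I t)) \<in> borel_measurable borel"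
    using I_meas by measurable
  also have "(\<lambda>t. (c * (1 - t) powr (c - 1)) * (indicator {0..1} t *\<^sub>R ?I t)) = ?h"
    by (auto simp: mult_ac)
  finally have meas: "?h \<in> borel_measurable borel" .
  have "(?h has_integral tilted_beta \<theta> a (c + 1)) {0..1}"
    using J by (rule has_integral_eq[rotated]) auto
  note R = set_integral_eq_has_integral_nonneg[OF this meas]
  have nn: "0 \<le> ?h x" for x
    using assms I lower_gamma_nonneg by (auto simp: indicator_def)
  have eq: "indicator {0..1} t *\<^sub>R ?h t =
      indicator {0..1} t *\<^sub>R (c * (1 - t) powr (c - 1) * lower_gamma \<theta> a t)" for t
    using I by (auto simp: indicator_def)
  show "set_integrable lborel {0..1} (\<lambda>t. c * (1 - t) powr (c - 1) * lower_gamma \<theta> a t)"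
    using R(1)[OF _ nn] unfolding set_integrable_def eq by simp
  show "(LBINT t:{0..1}. c * (1 - t) powr (c - 1) * lower_gamma \<theta> a t) = tilted_beta \<theta> a (c + 1)"
    using R(2)[OF _ nn] unfolding set_lebesgue_integral_def eq by simp
qed

section \<open>The cut balance equations and their unique solution\<close>

lemma summable_power_over_pochhammer:
  fixes \<theta> \<eta> :: real
  assumes "0 < \<theta>" "0 < \<eta>"
  shows "summable (\<lambda>n. \<theta> ^ n / pochhammer \<eta> n)"
proof (rule summable_ratio_test)
  \<comment> \<open>From this index on the ratio of consecutive terms,
    \<open>\<theta> / (\<eta> + real n)\<close>, is at most one half.\<close>
  fix n :: nat assume n: "nat \<lceil>2 * \<theta>\<rceil> \<le> n"
  have p: "0 < pochhammer \<eta> n"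
    using assms by (intro pochhammer_pos)
  have "2 * \<theta> \<le> \<eta> + real n"
    using n assms by linarith
  then have "\<theta> / (\<eta> + real n) \<le> 1 / 2"
    using assms by (simp add: field_simps)
  then have "\<theta> / (\<eta> + real n) * (\<theta> ^ n / pochhammer \<eta> n) \<le> 1 / 2 * (\<theta> ^ n / pochhammer \<eta> n)"
    using assms p by (intro mult_right_mono) auto
  then show "norm (\<theta> ^ Suc n / pochhammer \<eta> (Suc n)) \<le> 1 / 2 * norm (\<theta> ^ n / pochhammer \<eta> n)"
    using assms p by (simp add: pochhammer_Suc mult_ac)
qed auto

lemma summable_power_over_pochhammer_Suc:
  fixes \<theta> \<eta> :: real
  assumes "0 < \<theta>" "0 < \<eta>"
  shows "summable (\<lambda>n. \<theta> ^ n / pochhammer \<eta> (Suc n))"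
proof -
  have "summable (\<lambda>n. \<theta> ^ n / pochhammer (\<eta> + 1) n / \<eta>)"
    using assms by (intro summable_divide summable_power_over_pochhammer) auto
  then show ?thesis
    by (simp add: pochhammer_rec mult.commute)
qed

text \<open>Iterating \<open>lower_gamma_rec\<close> leaves the remainder \<open>?R n\<close>. It
  tends to 0: for \<open>s \<le> 1\<close> the integral decreases in its exponent, while the
  Pochhammer symbol outgrows the powers of \<theta>.\<close>

lemma lower_gamma_sums:
  assumes "0 < \<theta>" "0 < \<eta>" "0 \<le> s" "s \<le> 1"
  shows "(\<lambda>j. \<theta> ^ j / pochhammer \<eta> (Suc j) * (s powr (\<eta> + real j) * exp (- \<theta> * s)))
    sums lower_gamma \<theta> \<eta> s"
proof -
  let ?f = "\<lambda>j. \<theta> ^ j / pochhammer \<eta> (Suc j) * (s powr (\<eta> + real j) * exp (- \<theta> * s))"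
  let ?R = "\<lambda>n. \<theta> ^ n / pochhammer \<eta> n * lower_gamma \<theta> (\<eta> + real n) s"
  have poch: "0 < pochhammer \<eta> n" for n
    using assms by (intro pochhammer_pos)
  have R: "?R n = ?f n + ?R (Suc n)" for n
  proof -
    have "\<eta> + real n > 0"
      using assms by simp
    then have "lower_gamma \<theta> (\<eta> + real n) s =
        (s powr (\<eta> + real n) * exp (- \<theta> * s) + \<theta> * lower_gamma \<theta> (\<eta> + real n + 1) s) / (\<eta> + real n)"
      using lower_gamma_rec[of "\<eta> + real n" s \<theta>] assms by (simp add: field_simps)
    then show ?thesis
      using poch[of n] \<open>\<eta> + real n > 0\<close>
      by (simp add: pochhammer_Suc divide_simps add_ac) (simp add: algebra_simps)
  qed
  have partial: "(\<Sum>j<n. ?f j) = lower_gamma \<theta> \<eta> s - ?R n" for n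
  proof (induction n)
    case (Suc n)
    then show ?case using R[of n] by (simp only: sum.lessThan_Suc)
  qed simp
  have "(\<lambda>n. \<theta> ^ n / pochhammer \<eta> n * lower_gamma \<theta> \<eta> s) \<longlonglongrightarrow> 0"
    using assms by (intro tendsto_mult_left_zero summable_LIMSEQ_zero summable_power_over_pochhammer)
  then have "?R \<longlonglongrightarrow> 0"
  proof (rule Lim_null_comparison[rotated], intro always_eventually allI)
    fix n
    have c: "0 \<le> \<theta> ^ n / pochhammer \<eta> n"
      using assms by (intro divide_nonneg_pos poch) auto
    have "?R n \<le> \<theta> ^ n / pochhammer \<eta> n * lower_gamma \<theta> \<eta> s"
      using assms by (intro mult_left_mono lower_gamma_antimono c) auto
    then show "norm (?R n) \<le> \<theta> ^ n / pochhammer \<eta> n * lower_gamma \<theta> \<eta> s"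
      using mult_nonneg_nonneg[OF c lower_gamma_nonneg] by (simp only: real_norm_def abs_of_nonneg)
  qed
  then have "(\<lambda>n. lower_gamma \<theta> \<eta> s - ?R n) \<longlonglongrightarrow> lower_gamma \<theta> \<eta> s - 0"
    by (intro tendsto_intros)
  then show ?thesis
    unfolding sums_def partial by simp
qed

text \<open>Insert the series of the innermost integral. The factor \<open>inverse s\<close> lowers
  each exponent by one, so the middle integral is again an incomplete gamma integral, and
  \<open>beta_weighted_lower_gamma\<close> evaluates the outer one.\<close>

lemma iterated_integral_sums:
  assumes "0 < \<theta>" "0 < \<eta>" "0 < \<gamma>"
  shows "(\<lambda>j. \<theta> ^ j / pochhammer \<eta> (Suc j) * tilted_beta \<theta> (\<eta> + real j) (\<gamma> + 1)) sums
    (LBINT t:{0..1}. \<gamma> * (1 - t) powr (\<gamma> - 1) *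
       (LBINT s:{0..t}. inverse s * lower_gamma \<theta> \<eta> s))"
proof -
  let ?c = "\<lambda>j. \<theta> ^ j / pochhammer \<eta> (Suc j)"
  have c: "0 \<le> ?c j" for j
    using assms by (intro divide_nonneg_pos pochhammer_pos) auto
  have sc: "summable ?c"
    using assms by (intro summable_power_over_pochhammer_Suc)
  have inner: "(\<lambda>j. ?c j * lower_gamma \<theta> (\<eta> + real j) t) sums
      (LBINT s:{0..t}. inverse s * lower_gamma \<theta> \<eta> s)" if t: "t \<in> {0..1}" for t
  proof -
    let ?f = "\<lambda>j s. ?c j * (s powr (\<eta> + real j - 1) * exp (- \<theta> * s))"
    have int: "(LBINT s:{0..t}. ?f j s) = ?c j * lower_gamma \<theta> (\<eta> + real j) t" for j
      unfolding lower_gamma_def by (rule set_integral_mult_right)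
    have "(\<lambda>j. LBINT s:{0..t}. ?f j s) sums (LBINT s:{0..t}. inverse s * lower_gamma \<theta> \<eta> s)"
    proof (rule set_integral_sums_nonneg)
      show "set_integrable lborel {0..t} (?f j)" for j
        using assms t by (intro set_integrable_mult_right lower_gamma_integrable) auto
      show "0 \<le> ?f j s" for j s
        by (intro mult_nonneg_nonneg c) auto
      show "(\<lambda>j. ?f j s) sums (inverse s * lower_gamma \<theta> \<eta> s)" if s: "s \<in> {0..t}" for s
      proof -
        \<comment> \<open>At \<open>s = 0\<close> both sides are 0, since
          \<open>0 powr x = 0\<close> and \<open>inverse 0 = 0\<close>.\<close>
        have *: "?f j s = inverse s * (?c j * (s powr (\<eta> + real j) * exp (- \<theta> * s)))" for j
          using s by (cases "s = 0") (auto simp: powr_diff divide_simps)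
        show ?thesis
          unfolding * using assms s t by (intro sums_mult lower_gamma_sums) auto
      qed
      show "summable (\<lambda>j. LBINT s:{0..t}. ?f j s)"
        unfolding int
      proof (rule summable_comparison_test)
        show "\<exists>N. \<forall>j\<ge>N. norm (?c j * lower_gamma \<theta> (\<eta> + real j) t) \<le> ?c j * lower_gamma \<theta> \<eta> t"
        proof (intro exI allI impI)
          fix j :: nat
          have "?c j * lower_gamma \<theta> (\<eta> + real j) t \<le> ?c j * lower_gamma \<theta> \<eta> t"
            using assms t by (intro mult_left_mono lower_gamma_antimono c) auto
          then show "norm (?c j * lower_gamma \<theta> (\<eta> + real j) t) \<le> ?c j * lower_gamma \<theta> \<eta> t"
            using mult_nonneg_nonneg[OF c[of j] lower_gamma_nonneg[of \<theta> "\<eta> + real j" t]] by simp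
        qed
      qed (intro summable_mult2 sc)
    qed
    then show ?thesis
      unfolding int .
  qed
  let ?g = "\<lambda>j t. ?c j * (\<gamma> * (1 - t) powr (\<gamma> - 1) * lower_gamma \<theta> (\<eta> + real j) t)"
  have int: "(LBINT t:{0..1}. ?g j t) = ?c j * tilted_beta \<theta> (\<eta> + real j) (\<gamma> + 1)" for j
    using assms by (subst set_integral_mult_right) (subst beta_weighted_lower_gamma, auto)
  have "(\<lambda>j. LBINT t:{0..1}. ?g j t) sums (LBINT t:{0..1}. \<gamma> * (1 - t) powr (\<gamma> - 1) *
       (LBINT s:{0..t}. inverse s * lower_gamma \<theta> \<eta> s))"
  proof (rule set_integral_sums_nonneg)
    show "set_integrable lborel {0..1} (?g j)" for j
      using assms by (intro set_integrable_mult_right beta_weighted_lower_gamma) auto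
    show "0 \<le> ?g j s" for j s
      using assms by (intro mult_nonneg_nonneg c lower_gamma_nonneg) auto
    show "(\<lambda>j. ?g j t) sums (\<gamma> * (1 - t) powr (\<gamma> - 1) *
       (LBINT s:{0..t}. inverse s * lower_gamma \<theta> \<eta> s))" if "t \<in> {0..1}" for t
      using sums_mult[OF inner[OF that], of "\<gamma> * (1 - t) powr (\<gamma> - 1)"] by (simp add: mult_ac)
    show "summable (\<lambda>j. LBINT t:{0..1}. ?g j t)"
      unfolding int
    proof (rule summable_comparison_test)
      show "\<exists>N. \<forall>j\<ge>N. norm (?c j * tilted_beta \<theta> (\<eta> + real j) (\<gamma> + 1))
          \<le> ?c j * tilted_beta \<theta> \<eta> (\<gamma> + 1)"
      proof (intro exI allI impI)
        fix j :: nat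
        have "?c j * tilted_beta \<theta> (\<eta> + real j) (\<gamma> + 1) \<le> ?c j * tilted_beta \<theta> \<eta> (\<gamma> + 1)"
          using assms by (intro mult_left_mono tilted_beta_antimono c) auto
        then show "norm (?c j * tilted_beta \<theta> (\<eta> + real j) (\<gamma> + 1))
            \<le> ?c j * tilted_beta \<theta> \<eta> (\<gamma> + 1)"
          using mult_nonneg_nonneg[OF c[of j] tilted_beta_nonneg[of \<theta> "\<eta> + real j" "\<gamma> + 1"]] by simp
      qed
    qed (intro summable_mult2 sc)
  qed
  then show ?thesis
    unfolding int .
qed

text \<open>\<open>T n\<close> stands for the tail \<open>p (n + 1) + p (n + 2) + \<dots>\<close>, and the first clause equates the
  probability flows between \<open>{0..n}\<close> and its complement, in units of \<open>\<nu>\<close>.\<close>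

definition cut_balance :: "real \<Rightarrow> real \<Rightarrow> real \<Rightarrow> (nat \<Rightarrow> real) \<Rightarrow> (nat \<Rightarrow> real) \<Rightarrow> bool" where
  "cut_balance \<theta> \<gamma> \<eta> p T \<longleftrightarrow>
     (\<forall>n. \<theta> * p n = (\<eta> + real n) * p (Suc n) + \<gamma> * T n) \<and>
     (\<forall>n. T n = T (Suc n) + p (Suc n)) \<and> T \<longlonglongrightarrow> 0"

section \<open>Linearity, uniqueness and an explicit solution of the balance equations\<close>

lemma cut_balanceD:
  assumes "cut_balance \<theta> \<gamma> \<eta> p T"
  shows "\<theta> * p n = (\<eta> + real n) * p (Suc n) + \<gamma> * T n"
    and "T n = T (Suc n) + p (Suc n)"
    and "T \<longlonglongrightarrow> 0"
  using assms unfolding cut_balance_def by blast+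

text \<open>By linearity two solutions can be compared through a difference that starts at
  0.\<close>

lemma cut_balance_lincomb:
  assumes "cut_balance \<theta> \<gamma> \<eta> p T" "cut_balance \<theta> \<gamma> \<eta> q r"
  shows "cut_balance \<theta> \<gamma> \<eta> (\<lambda>n. p n - c * q n) (\<lambda>n. T n - c * r n)"
  unfolding cut_balance_def
proof (intro conjI allI)
  fix n
  note 1 = cut_balanceD(1,2)[OF assms(1), of n]
  note 2 = cut_balanceD(1,2)[OF assms(2), of n]
  have "\<theta> * (p n - c * q n) = \<theta> * p n - c * (\<theta> * q n)"
    by (simp add: algebra_simps)
  then show "\<theta> * (p n - c * q n) =
      (\<eta> + real n) * (p (Suc n) - c * q (Suc n)) + \<gamma> * (T n - c * r n)"
    unfolding 1(1) 2(1) by (simp add: algebra_simps)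
  show "T n - c * r n = T (Suc n) - c * r (Suc n) + (p (Suc n) - c * q (Suc n))"
    unfolding 1(2) 2(2) by (simp add: algebra_simps)
next
  have "(\<lambda>n. T n - c * r n) \<longlonglongrightarrow> 0 - c * 0"
    by (intro tendsto_intros cut_balanceD(3)[OF assms(1)] cut_balanceD(3)[OF assms(2)])
  then show "(\<lambda>n. T n - c * r n) \<longlonglongrightarrow> 0" by simp
qed

text \<open>A positive initial tail would force the tails to increase forever.\<close>

lemma cut_balance_tail_nonpos:
  assumes "0 < \<theta>" "0 < \<gamma>" "0 < \<eta>" and bal: "cut_balance \<theta> \<gamma> \<eta> d t" and "d 0 = 0"
  shows "t 0 \<le> 0"
proof (rule ccontr)
  assume neg: "\<not> t 0 \<le> 0"
  note rec = cut_balanceD(1,2)[OF bal]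
  \<comment> \<open>With \<open>d n \<le> 0\<close> and a positive tail the balance equation forces
    \<open>d (Suc n) \<le> 0\<close>, and then the tail recursion gives
    \<open>t (Suc n) \<ge> t n\<close>. This rules out the limit 0.\<close>
  have inv: "d n \<le> 0 \<and> t 0 \<le> t n" for n
  proof (induction n)
    case (Suc n)
    have "\<theta> * d n \<le> 0" "0 \<le> \<gamma> * t n"
      using Suc neg assms by (auto intro: mult_nonneg_nonpos)
    then have "(\<eta> + real n) * d (Suc n) \<le> 0"
      using rec(1)[of n] by linarith
    then have "d (Suc n) \<le> 0"
      using assms by (simp add: mult_le_0_iff)
    then show ?case
      using rec(2)[of n] Suc by linarith
  qed (use \<open>d 0 = 0\<close> in simp)
  have "t 0 \<le> 0"
    by (rule LIMSEQ_le_const[OF cut_balanceD(3)[OF bal]]) (use inv in auto)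
  with neg show False by simp
qed

text \<open>The sign bound applies to the solution and to its negative, so \<open>t 0 = 0\<close>;
  from there the two recursions propagate zero.\<close>

lemma cut_balance_zero:
  assumes "0 < \<theta>" "0 < \<gamma>" "0 < \<eta>" and bal: "cut_balance \<theta> \<gamma> \<eta> d t" and "d 0 = 0"
  shows "d n = 0 \<and> t n = 0"
proof (induction n)
  case 0
  have "cut_balance \<theta> \<gamma> \<eta> (\<lambda>_. 0) (\<lambda>_. 0)"
    by (simp add: cut_balance_def)
  from cut_balance_lincomb[OF this bal, of 1]
  have "cut_balance \<theta> \<gamma> \<eta> (\<lambda>n. - d n) (\<lambda>n. - t n)"
    by simp
  then show ?case
    using cut_balance_tail_nonpos[OF assms(1-3), of d t]
      cut_balance_tail_nonpos[OF assms(1-3), of "\<lambda>n. - d n" "\<lambda>n. - t n"] assms by simp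
next
  case (Suc n)
  show ?case
    using cut_balanceD(1,2)[OF bal, of n]
      Suc assms by (auto simp: add_pos_nonneg less_imp_neq[symmetric])
qed

text \<open>The factor \<open>p 0 / q 0\<close> is the one for which the difference of the solutions
  vanishes at 0.\<close>

lemma cut_balance_tail_unique:
  assumes "0 < \<theta>" "0 < \<gamma>" "0 < \<eta>"
    and "cut_balance \<theta> \<gamma> \<eta> p T" "cut_balance \<theta> \<gamma> \<eta> q r" "q 0 \<noteq> 0"
  shows "T n = p 0 / q 0 * r n"
  using cut_balance_zero[OF assms(1-3) cut_balance_lincomb[OF assms(4,5), of "p 0 / q 0"], of n] assms(6)
  by auto

text \<open>Up to the prefactors, \<open>tilted_beta_split\<close> is the balance equation and
  \<open>tilted_beta_rec\<close> is the tail recursion. The tails vanish because the prefactor does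
  and the beta integral decreases in \<open>n\<close>.\<close>

lemma cut_balance_explicit:
  assumes "0 < \<theta>" "0 < \<gamma>" "0 < \<eta>"
  shows "cut_balance \<theta> \<gamma> \<eta>
    (\<lambda>n. \<theta> ^ n / pochhammer \<eta> n * (\<gamma> * tilted_beta \<theta> (\<eta> + real n) \<gamma>))
    (\<lambda>n. \<theta> ^ Suc n / pochhammer \<eta> n * tilted_beta \<theta> (\<eta> + real n) (\<gamma> + 1))"
  unfolding cut_balance_def
proof (intro conjI allI)
  fix n
  let ?a = "\<eta> + real n"
  let ?b = "tilted_beta \<theta>"
  have poch: "0 < pochhammer \<eta> m" for m
    using assms by (intro pochhammer_pos)
  have a: "0 < ?a"
    using assms by simp
  have Suc: "\<eta> + real (Suc n) = ?a + 1"
    by simp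
  define x where "x = \<theta> ^ Suc n / pochhammer \<eta> (Suc n)"
  have x: "\<theta> ^ Suc n / pochhammer \<eta> n = ?a * x"
    using a by (simp add: x_def pochhammer_Suc)
  have split: "?b ?a \<gamma> = ?b (?a + 1) \<gamma> + ?b ?a (\<gamma> + 1)"
    using tilted_beta_split[of ?a \<gamma> \<theta>] assms a by simp
  have parts: "?a * ?b ?a (\<gamma> + 1) = \<theta> * ?b (?a + 1) (\<gamma> + 1) + \<gamma> * ?b (?a + 1) \<gamma>"
    using tilted_beta_rec[of ?a \<gamma> \<theta>] assms a by simp
  have "\<theta> * (\<theta> ^ n / pochhammer \<eta> n * (\<gamma> * ?b ?a \<gamma>)) =
      \<theta> ^ Suc n / pochhammer \<eta> n * (\<gamma> * ?b ?a \<gamma>)"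
    by simp
  also have "\<dots> = ?a * (x * (\<gamma> * ?b (?a + 1) \<gamma>)) + \<gamma> * (?a * x * ?b ?a (\<gamma> + 1))"
    unfolding x split by (simp only: distrib_left distrib_right mult_ac)
  finally show "\<theta> * (\<theta> ^ n / pochhammer \<eta> n * (\<gamma> * ?b ?a \<gamma>)) =
      ?a * (\<theta> ^ Suc n / pochhammer \<eta> (Suc n) * (\<gamma> * ?b (\<eta> + real (Suc n)) \<gamma>)) +
      \<gamma> * (\<theta> ^ Suc n / pochhammer \<eta> n * ?b ?a (\<gamma> + 1))"
    unfolding Suc x x_def[symmetric] .
  have "\<theta> ^ Suc n / pochhammer \<eta> n * ?b ?a (\<gamma> + 1) = x * (?a * ?b ?a (\<gamma> + 1))"
    unfolding x by simp
  also have "\<dots> = \<theta> * x * ?b (?a + 1) (\<gamma> + 1) + x * (\<gamma> * ?b (?a + 1) \<gamma>)"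
    unfolding parts by (simp only: distrib_left mult_ac)
  finally show "\<theta> ^ Suc n / pochhammer \<eta> n * ?b ?a (\<gamma> + 1) =
      \<theta> ^ Suc (Suc n) / pochhammer \<eta> (Suc n) * ?b (\<eta> + real (Suc n)) (\<gamma> + 1) +
      \<theta> ^ Suc n / pochhammer \<eta> (Suc n) * (\<gamma> * ?b (\<eta> + real (Suc n)) \<gamma>)"
    unfolding Suc x_def by simp
next
  let ?c = "\<lambda>n. \<theta> * (\<theta> ^ n / pochhammer \<eta> n)"
  let ?b = "\<lambda>n. tilted_beta \<theta> (\<eta> + real n) (\<gamma> + 1)"
  have c: "0 \<le> ?c n" for n
    using assms by (intro mult_nonneg_nonneg divide_nonneg_pos pochhammer_pos) auto
  have "(\<lambda>n. ?c n * ?b 0) \<longlonglongrightarrow> 0"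
    using assms by (intro tendsto_mult_left_zero tendsto_mult_right_zero summable_LIMSEQ_zero
      summable_power_over_pochhammer)
  then have "(\<lambda>n. ?c n * ?b n) \<longlonglongrightarrow> 0"
  proof (rule Lim_null_comparison[rotated], intro always_eventually allI)
    fix n
    have "?c n * ?b n \<le> ?c n * ?b 0"
      using assms by (intro mult_left_mono tilted_beta_antimono c) auto
    then show "norm (?c n * ?b n) \<le> ?c n * ?b 0"
      using mult_nonneg_nonneg[OF c tilted_beta_nonneg] by (simp only: real_norm_def abs_of_nonneg)
  qed
  then show "(\<lambda>n. \<theta> ^ Suc n / pochhammer \<eta> n * ?b n) \<longlonglongrightarrow> 0"
    by simp
qed

text \<open>Tonelli on the triangle \<open>j < n\<close>: row \<open>j\<close> sums to
  \<open>c j * T j\<close>, column \<open>n\<close> to \<open>p n\<close> times a partial sum of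
  \<open>c\<close>.\<close>

lemma sums_tail_weighted:
  fixes p T c :: "nat \<Rightarrow> real"
  assumes nonneg: "\<And>n. 0 \<le> p n" "\<And>n. 0 \<le> c n"
    and tail: "\<And>n. (\<lambda>k. p (k + Suc n)) sums T n"
    and S: "(\<lambda>j. c j * T j) sums S"
  shows "(\<lambda>n. p n * (\<Sum>j<n. c j)) sums S"
proof -
  let ?f = "\<lambda>(j, n). if j < n then c j * p n else 0"
  have T: "0 \<le> T n" for n
    by (rule sums_le[OF _ sums_zero tail]) (rule nonneg)
  have row: "((\<lambda>n. ?f (j, n)) has_sum (c j * T j)) UNIV" for j
  proof (rule sums_nonneg_imp_has_sum)
    have "(\<lambda>k. ?f (j, k + Suc j)) sums (c j * T j)"
      using sums_mult[OF tail, of "c j" j] by simp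
    moreover have "(\<Sum>n<Suc j. ?f (j, n)) = 0"
      by (intro sum.neutral) auto
    ultimately show "(\<lambda>n. ?f (j, n)) sums (c j * T j)"
      using sums_iff_shift[of "\<lambda>n. ?f (j, n)" "Suc j" "c j * T j"] by simp
  qed (use nonneg in auto)
  have S': "((\<lambda>j. c j * T j) has_sum S) UNIV"
    using S nonneg T by (intro sums_nonneg_imp_has_sum) auto
  have "?f summable_on UNIV \<times> UNIV"
    by (rule summable_on_SigmaI[OF row has_sum_imp_summable[OF S']]) (use nonneg in auto)
  then have "(?f has_sum S) (UNIV \<times> UNIV)"
    by (intro has_sum_SigmaI[OF row S'])
  then have swapped: "((\<lambda>(n, j). ?f (j, n)) has_sum S) (UNIV \<times> UNIV)"
    by (subst (asm) has_sum_swap)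
  have col: "((\<lambda>j. (\<lambda>(n, j). ?f (j, n)) (n, j)) has_sum p n * (\<Sum>j<n. c j)) UNIV" for n
    by (rule has_sum_finite_neutralI[where B = "{..<n}"])
      (auto simp: sum_distrib_left mult.commute)
  show ?thesis
    by (rule has_sum_imp_sums[OF has_sum_SigmaD[OF swapped col]])
qed

section \<open>Stationary distributions balance the flow across cuts\<close>

lemma transition_functionD:
  assumes "transition_function Q P"
  shows "0 \<le> t \<Longrightarrow> 0 \<le> P t i j"
    and "0 \<le> t \<Longrightarrow> ((\<lambda>j. P t i j) has_sum 1) UNIV"
    and "P 0 i j = (if i = j then 1 else 0)"
    and "0 \<le> s \<Longrightarrow> 0 \<le> t \<Longrightarrow> ((\<lambda>k. P s i k * P t k j) has_sum P (s + t) i j) UNIV"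
    and "((\<lambda>t. P t i j) has_real_derivative Q i j) (at 0 within {0..})"
  using assms unfolding transition_function_def by blast+

lemma stationary_distributionD:
  assumes "stationary_distribution P \<pi>"
  shows "0 \<le> \<pi> i" and "(\<pi> has_sum 1) UNIV"
    and "0 \<le> t \<Longrightarrow> ((\<lambda>i. \<pi> i * P t i j) has_sum \<pi> j) UNIV"
  using assms unfolding stationary_distribution_def by blast+

lemma transition_rate_LIMSEQ:
  assumes "transition_function Q P" "h \<longlonglongrightarrow> 0" "\<And>m. 0 < h m"
  shows "(\<lambda>m. (P (h m) i j - (if i = j then 1 else 0)) / h m) \<longlonglongrightarrow> Q i j"
proof -
  have "((\<lambda>y. (P y i j - P 0 i j) / (y - 0)) \<longlongrightarrow> Q i j) (at 0 within {0..})"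
    using transition_functionD(5)[OF assms(1), of i j] by (simp only: has_field_derivative_iff)
  moreover have "filterlim h (at 0 within {0..}) sequentially"
    using assms(2,3) by (auto simp: filterlim_at less_imp_le less_imp_neq[symmetric])
  ultimately have "(\<lambda>m. (P (h m) i j - P 0 i j) / (h m - 0)) \<longlonglongrightarrow> Q i j"
    by (rule filterlim_compose)
  then show ?thesis
    by (simp only: transition_functionD(3)[OF assms(1)] diff_0_right)
qed

lemma transition_sum_le_1:
  assumes "transition_function Q P" "0 \<le> t" "finite F"
  shows "(\<Sum>j\<in>F. P t i j) \<le> 1"
  using finite_sum_le_has_sum[OF transition_functionD(2)[OF assms(1,2)], of F]
    assms transition_functionD(1)[OF assms(1,2)] by simp

lemma transition_le_1:
  assumes "transition_function Q P" "0 \<le> t"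
  shows "P t i j \<le> 1"
  using transition_sum_le_1[OF assms, of "{j}"] by simp

text \<open>The diagonal is supermultiplicative, hence \<open>1 - P t i i \<le> m (1 - P (t / m) i i)\<close>; let \<open>m\<close>
  tend to infinity.\<close>

lemma transition_diagonal_bound:
  assumes tf: "transition_function Q P" and "0 < t"
  shows "1 - P t i i \<le> - Q i i * t"
proof -
  have super: "1 - P (real m * s) i i \<le> real m * (1 - P s i i)" if s: "0 \<le> s" for m s
  proof (induction m)
    case (Suc m)
    let ?a = "P s i i" and ?b = "P (real m * s) i i"
    \<comment> \<open>Only the term \<open>k = i\<close> of the Chapman-Kolmogorov sum is
      kept.\<close>
    have "(\<Sum>k\<in>{i}. P s i k * P (real m * s) k i) \<le> P (s + real m * s) i i"
      using s transition_functionD(1)[OF tf]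
      by (intro finite_sum_le_has_sum[OF transition_functionD(4)[OF tf]]) auto
    then have "?a * ?b \<le> P (real (Suc m) * s) i i"
      by (simp add: distrib_right)
    \<comment> \<open>Expanded, this says \<open>1 - ?a * ?b \<le> (1 - ?a) + (1 - ?b)\<close>,
      which makes the defects add up.\<close>
    moreover have "0 \<le> (1 - ?a) * (1 - ?b)"
      using s transition_le_1[OF tf] by simp
    ultimately show ?case
      using Suc by (simp add: algebra_simps)
  qed (simp add: transition_functionD(3)[OF tf])
  let ?h = "\<lambda>m. t / real (Suc m)"
  have "(\<lambda>m. (P (?h m) i i - (if i = i then 1 else 0)) / ?h m) \<longlonglongrightarrow> Q i i"
  proof (rule transition_rate_LIMSEQ[OF tf])
    show "?h \<longlonglongrightarrow> 0"
      by (rule LIMSEQ_Suc[OF lim_const_over_n])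
  qed (use assms in auto)
  then have "(\<lambda>m. - ((P (?h m) i i - 1) / ?h m) * t) \<longlonglongrightarrow> - Q i i * t"
    by (intro tendsto_intros) simp
  moreover have "1 - P t i i \<le> - ((P (?h m) i i - 1) / ?h m) * t" for m
  proof -
    have "- ((P (?h m) i i - 1) / ?h m) * t = real (Suc m) * (1 - P (?h m) i i)"
      using assms(2) by (simp add: field_simps del: of_nat_Suc)
    then show ?thesis
      using super[of "?h m" "Suc m"] assms(2) by (simp del: of_nat_Suc)
  qed
  ultimately show ?thesis
    by (intro LIMSEQ_le_const) auto
qed

context
  fixes Q :: "nat \<Rightarrow> nat \<Rightarrow> real" and P :: "real \<Rightarrow> nat \<Rightarrow> nat \<Rightarrow> real" and \<pi> :: "nat \<Rightarrow> real"
  assumes tf: "transition_function Q P" and st: "stationary_distribution P \<pi>"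
begin

text \<open>Summing stationarity over the targets \<open>j \<le> n\<close> and moving the sources
  \<open>i \<le> n\<close> to the other side equates the mass entering \<open>{..n}\<close> during
  time \<open>t\<close> with the mass leaving it.\<close>

lemma stationary_cut_sums:
  assumes "0 \<le> t"
  shows "(\<lambda>k. \<pi> (k + Suc n) * (\<Sum>j\<le>n. P t (k + Suc n) j)) sums (\<Sum>i\<le>n. \<pi> i * (1 - (\<Sum>j\<le>n. P t i j)))"
proof -
  have "(\<lambda>i. \<pi> i * (\<Sum>j\<le>n. P t i j)) sums (\<Sum>j\<le>n. \<pi> j)"
    unfolding sum_distrib_left
    by (intro sums_sum has_sum_imp_sums stationary_distributionD(3)[OF st] assms)
  also have "(\<Sum>j\<le>n. \<pi> j) = (\<Sum>i\<le>n. \<pi> i * (1 - (\<Sum>j\<le>n. P t i j))) +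
      (\<Sum>i<Suc n. \<pi> i * (\<Sum>j\<le>n. P t i j))"
    by (simp add: lessThan_Suc_atMost algebra_simps sum_subtractf)
  finally show ?thesis
    using sums_iff_shift[of "\<lambda>i. \<pi> i * (\<Sum>j\<le>n. P t i j)" "Suc n"
        "\<Sum>i\<le>n. \<pi> i * (1 - (\<Sum>j\<le>n. P t i j))"]
    by blast
qed

private definition "h m = 1 / real (Suc m)"
private definition "flux_in n k m = \<pi> (k + Suc n) * ((\<Sum>j\<le>n. P (h m) (k + Suc n) j) / h m)"

private lemma h: "h \<longlonglongrightarrow> 0" "0 < h m"
  unfolding h_def using LIMSEQ_Suc[OF lim_const_over_n[of "1 :: real"]] by auto

private lemma flux_in_nonneg: "0 \<le> flux_in n k m"
  unfolding flux_in_def using h(2)[of m]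
  by (intro mult_nonneg_nonneg divide_nonneg_pos sum_nonneg stationary_distributionD(1)[OF st]
    transition_functionD(1)[OF tf]) auto

private lemma flux_in_LIMSEQ:
  "(\<lambda>m. flux_in n k m) \<longlonglongrightarrow> \<pi> (k + Suc n) * (\<Sum>j\<le>n. Q (k + Suc n) j)"
proof -
  have "(\<lambda>m. \<pi> (k + Suc n) * (\<Sum>j\<le>n. (P (h m) (k + Suc n) j - (if k + Suc n = j then 1 else 0)) / h m))
      \<longlonglongrightarrow> \<pi> (k + Suc n) * (\<Sum>j\<le>n. Q (k + Suc n) j)"
    by (intro tendsto_intros transition_rate_LIMSEQ[OF tf] h)
  \<comment> \<open>The identity entries vanish because the source \<open>k + Suc n\<close> exceeds
    every target.\<close>
  also have "(\<lambda>m. \<pi> (k + Suc n) *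
        (\<Sum>j\<le>n. (P (h m) (k + Suc n) j - (if k + Suc n = j then 1 else 0)) / h m)) =
      (\<lambda>m. flux_in n k m)"
    unfolding flux_in_def sum_divide_distrib
    by (intro ext arg_cong2[where f = "(*)"] refl sum.cong) auto
  finally show ?thesis .
qed

private lemma flux_in_sums:
  "(\<lambda>k. flux_in n k m) sums (\<Sum>i\<le>n. \<pi> i * ((1 - (\<Sum>j\<le>n. P (h m) i j)) / h m))"
proof -
  have "(\<lambda>k. flux_in n k m) sums ((\<Sum>i\<le>n. \<pi> i * (1 - (\<Sum>j\<le>n. P (h m) i j))) / h m)"
    unfolding flux_in_def times_divide_eq_right using h(2)[of m]
    by (intro sums_divide stationary_cut_sums) simp
  then show ?thesis
    unfolding times_divide_eq_right
    by (subst (asm) sum_divide_distrib)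
qed

private lemma flux_out_LIMSEQ:
  "(\<lambda>m. \<Sum>i\<le>n. \<pi> i * ((1 - (\<Sum>j\<le>n. P (h m) i j)) / h m)) \<longlonglongrightarrow> (\<Sum>i\<le>n. \<pi> i * - (\<Sum>j\<le>n. Q i j))"
proof -
  have "(\<lambda>m. \<Sum>i\<le>n. \<pi> i * - (\<Sum>j\<le>n. (P (h m) i j - (if i = j then 1 else 0)) / h m)) \<longlonglongrightarrow>
      (\<Sum>i\<le>n. \<pi> i * - (\<Sum>j\<le>n. Q i j))"
    by (intro tendsto_intros transition_rate_LIMSEQ[OF tf] h)
  also have "(\<lambda>m. \<Sum>i\<le>n. \<pi> i * - (\<Sum>j\<le>n. (P (h m) i j - (if i = j then 1 else 0)) / h m)) =
      (\<lambda>m. \<Sum>i\<le>n. \<pi> i * ((1 - (\<Sum>j\<le>n. P (h m) i j)) / h m))"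
  proof (intro ext sum.cong refl arg_cong2[where f = "(*)"])
    fix m i assume "i \<in> {..n}"
    then have "(\<Sum>j\<le>n. if i = j then 1 else 0 :: real) = 1"
      by simp
    then have "(\<Sum>j\<le>n. (P (h m) i j - (if i = j then 1 else 0)) / h m) = ((\<Sum>j\<le>n. P (h m) i j) - 1) / h m"
      by (simp only: sum_divide_distrib[symmetric] sum_subtractf)
    then show "- (\<Sum>j\<le>n. (P (h m) i j - (if i = j then 1 else 0)) / h m) =
        (1 - (\<Sum>j\<le>n. P (h m) i j)) / h m"
      by (simp add: minus_divide_left)
  qed
  finally show ?thesis .
qed

text \<open>At each time step one inflow term is at most the whole inflow, which equals the outflow,
  and the bound survives the limit. For the queue it yields the moment bound behind the summability
  assumption of \<open>stationary_cut_balance\<close>.\<close>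

lemma stationary_cut_le:
  "\<pi> (k + Suc n) * (\<Sum>j\<le>n. Q (k + Suc n) j) \<le> (\<Sum>i\<le>n. \<pi> i * - (\<Sum>j\<le>n. Q i j))"
proof (rule LIMSEQ_le[OF flux_in_LIMSEQ flux_out_LIMSEQ], intro exI allI impI)
  fix m
  show "flux_in n k m \<le> (\<Sum>i\<le>n. \<pi> i * ((1 - (\<Sum>j\<le>n. P (h m) i j)) / h m))"
    using sum_le_suminf[OF sums_summable[OF flux_in_sums[where n = n and m = m]], of "{k}"]
    unfolding sums_unique[OF flux_in_sums[where n = n and m = m], symmetric]
    by (simp add: flux_in_nonneg)
qed

text \<open>\<open>(1 - P h i i) / h \<le> - Q i i\<close> dominates the difference quotients, so the limit may be
  taken inside the sum.\<close>

lemma stationary_cut_balance: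
  assumes "summable (\<lambda>i. \<pi> i * - Q i i)"
  shows "(\<lambda>k. \<pi> (k + Suc n) * (\<Sum>j\<le>n. Q (k + Suc n) j)) sums (\<Sum>i\<le>n. \<pi> i * - (\<Sum>j\<le>n. Q i j))"
proof -
  let ?M = "\<lambda>k. \<pi> (k + Suc n) * - Q (k + Suc n) (k + Suc n)"
  have M: "summable ?M"
    using summable_iff_shift[of "\<lambda>i. \<pi> i * - Q i i" "Suc n"] assms by blast
  have bound: "norm (flux_in n k m) \<le> ?M k" for k m
  proof -
    let ?i = "k + Suc n"
    \<comment> \<open>The source lies above the cut, so the probability of reaching
      \<open>{..n}\<close> is at most that of leaving the source.\<close>
    have "(\<Sum>j\<le>n. P (h m) ?i j) + P (h m) ?i ?i = (\<Sum>j\<in>insert ?i {..n}. P (h m) ?i j)"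
      by simp
    also have "\<dots> \<le> 1"
      using h(2)[of m] by (intro transition_sum_le_1[OF tf]) auto
    finally have "(\<Sum>j\<le>n. P (h m) ?i j) \<le> - Q ?i ?i * h m"
      using transition_diagonal_bound[OF tf h(2)[of m], of ?i] by linarith
    then have "(\<Sum>j\<le>n. P (h m) ?i j) / h m \<le> - Q ?i ?i"
      using h(2)[of m] by (simp only: pos_divide_le_eq)
    then show ?thesis
      using flux_in_nonneg[of n k m] stationary_distributionD(1)[OF st, of ?i]
      unfolding flux_in_def by (simp only: real_norm_def abs_of_nonneg mult_left_mono)
  qed
  have lim: "summable (\<lambda>k. norm (\<pi> (k + Suc n) * (\<Sum>j\<le>n. Q (k + Suc n) j))) \<and>
      (\<lambda>m. \<Sum>k. flux_in n k m) \<longlonglongrightarrow> (\<Sum>k. \<pi> (k + Suc n) * (\<Sum>j\<le>n. Q (k + Suc n) j))"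
    using tannerys_theorem[where a = "flux_in n" and F = sequentially, OF flux_in_LIMSEQ _ M]
      bound by (auto simp: case_prod_unfold)
  have "(\<lambda>m. \<Sum>k. flux_in n k m) \<longlonglongrightarrow> (\<Sum>i\<le>n. \<pi> i * - (\<Sum>j\<le>n. Q i j))"
    unfolding sums_unique[OF flux_in_sums, symmetric] by (rule flux_out_LIMSEQ)
  then have "(\<Sum>k. \<pi> (k + Suc n) * (\<Sum>j\<le>n. Q (k + Suc n) j)) = (\<Sum>i\<le>n. \<pi> i * - (\<Sum>j\<le>n. Q i j))"
    by (rule LIMSEQ_unique[OF conjunct2[OF lim]])
  then show ?thesis
    using summable_sums[OF summable_norm_cancel[OF conjunct1[OF lim]]] by (simp only:)
qed

end

section \<open>Partial row sums of the generator and the balance equations of the queue\<close>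

lemma sum_queue_generator_above:
  assumes "n < i"
  shows "(\<Sum>j\<le>n. queue_generator lam \<mu> \<nu> \<kappa> i j) = \<kappa> + (if i = Suc n then \<mu> + real n * \<nu> else 0)"
proof -
  \<comment> \<open>A source above the cut enters \<open>{..n}\<close> by resetting or by one step
    down, the latter only from \<open>Suc n\<close>.\<close>
  have "(\<Sum>j\<le>n. queue_generator lam \<mu> \<nu> \<kappa> i j) =
      (\<Sum>j\<le>n. (if j = i - 1 then \<mu> + (real i - 1) * \<nu> else 0) + (if j = 0 then \<kappa> else 0))"
    using assms by (intro sum.cong) (auto simp: queue_generator_def queue_rate_def)
  also have "\<dots> = (if i - 1 \<le> n then \<mu> + (real i - 1) * \<nu> else 0) + \<kappa>"
    by (simp add: sum.distrib)
  finally show ?thesis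
    using assms by auto
qed

text \<open>Full rows sum to 0, so a partial row sum is minus the rate of leaving
  \<open>{..n}\<close>; only an arrival in state \<open>n\<close> crosses the cut upwards.\<close>

lemma sum_queue_generator_below:
  assumes "i \<le> n"
  shows "(\<Sum>j\<le>n. queue_generator lam \<mu> \<nu> \<kappa> i j) = (if i = n then - lam else 0)"
proof -
  let ?r = "queue_rate lam \<mu> \<nu> \<kappa> i"
  have "(\<Sum>j\<le>n. queue_generator lam \<mu> \<nu> \<kappa> i j) =
      queue_generator lam \<mu> \<nu> \<kappa> i i + (\<Sum>j\<in>{..n} - {i}. queue_generator lam \<mu> \<nu> \<kappa> i j)"
    using assms by (intro sum.remove) auto
  also have "(\<Sum>j\<in>{..n} - {i}. queue_generator lam \<mu> \<nu> \<kappa> i j) = (\<Sum>j\<in>{..n} - {i}. ?r j)"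
    by (intro sum.cong) (auto simp: queue_generator_def)
  finally have *: "(\<Sum>j\<le>n. queue_generator lam \<mu> \<nu> \<kappa> i j) =
      (\<Sum>j\<in>{..n} - {i}. ?r j) - (\<Sum>j\<in>{0..i + 1} - {i}. ?r j)"
    by (simp add: queue_generator_def)
  show ?thesis
  proof (cases "i = n")
    case True
    have "{0..i + 1} - {i} = insert (Suc n) ({..n} - {i})"
      using True by auto
    then have "(\<Sum>j\<in>{0..i + 1} - {i}. ?r j) = ?r (Suc n) + (\<Sum>j\<in>{..n} - {i}. ?r j)"
      by simp
    then show ?thesis
      using * True by (auto simp: queue_rate_def)
  next
    case False
    then have "(\<Sum>j\<in>{0..i + 1} - {i}. ?r j) = (\<Sum>j\<in>{..n} - {i}. ?r j)"
      using assms by (intro sum.mono_neutral_left) (auto simp: queue_rate_def)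
    then show ?thesis
      using * False by simp
  qed
qed

text \<open>The diagonal entry is the difference of the row sums over \<open>{..Suc n}\<close> and
  \<open>{..n}\<close>.\<close>

lemma queue_generator_diagonal_Suc:
  "- queue_generator lam \<mu> \<nu> \<kappa> (Suc n) (Suc n) = lam + \<mu> + real n * \<nu> + \<kappa>"
  using sum_queue_generator_above[of n "Suc n" lam \<mu> \<nu> \<kappa>]
    sum_queue_generator_below[of "Suc n" "Suc n" lam \<mu> \<nu> \<kappa>]
  by simp

lemma queue_cut_balance:
  assumes pos: "lam > 0" "\<mu> > 0" "\<nu> > 0" "\<kappa> > 0"
    and tf: "transition_function (queue_generator lam \<mu> \<nu> \<kappa>) P"
    and st: "stationary_distribution P \<pi>"
  shows "cut_balance (lam / \<nu>) (\<kappa> / \<nu>) (\<mu> / \<nu>) \<pi> (\<lambda>n. \<Sum>k. \<pi> (k + Suc n))"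
    and "(\<lambda>n. real n * \<pi> (Suc n)) sums (\<Sum>n. real n * \<pi> (Suc n))"
proof -
  let ?Q = "queue_generator lam \<mu> \<nu> \<kappa>"
  note nonneg = stationary_distributionD(1)[OF st]
  have sm: "summable \<pi>"
    using has_sum_imp_sums[OF stationary_distributionD(2)[OF st]] by (rule sums_summable)
  have sm_Suc: "summable (\<lambda>n. \<pi> (Suc n))"
    using sm by (simp only: summable_Suc_iff)
  have out: "(\<Sum>i\<le>n. \<pi> i * - (\<Sum>j\<le>n. ?Q i j)) = lam * \<pi> n" for n
  proof -
    have "(\<Sum>i\<le>n. \<pi> i * - (\<Sum>j\<le>n. ?Q i j)) = (\<Sum>i\<le>n. if i = n then lam * \<pi> n else 0)"
      by (intro sum.cong) (auto simp: sum_queue_generator_below)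
    then show ?thesis by simp
  qed
  have into: "(\<Sum>j\<le>n. ?Q (k + Suc n) j) = \<kappa> + (if k = 0 then \<mu> + real n * \<nu> else 0)" for n k
    by (subst sum_queue_generator_above) auto
  \<comment> \<open>The inflow from the state just above the cut contains the departure rate, which
    grows like \<open>real n * \<nu>\<close>. Bounding this single term by the outflow already
    controls the first moment.\<close>
  have le: "real n * \<pi> (Suc n) \<le> lam / \<nu> * \<pi> n" for n
  proof -
    have "\<pi> (Suc n) * (\<kappa> + (\<mu> + real n * \<nu>)) \<le> lam * \<pi> n"
      using stationary_cut_le[OF tf st, of 0 n] unfolding out into by simp
    moreover have "0 \<le> \<pi> (Suc n) * (\<kappa> + \<mu>)"
      using nonneg[of "Suc n"] pos by simp
    ultimately show ?thesis
      using pos by (simp add: field_simps)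
  qed
  show "(\<lambda>n. real n * \<pi> (Suc n)) sums (\<Sum>n. real n * \<pi> (Suc n))"
  proof (rule summable_sums, rule summable_comparison_test)
    show "\<exists>N. \<forall>n\<ge>N. norm (real n * \<pi> (Suc n)) \<le> lam / \<nu> * \<pi> n"
      using le nonneg by (simp add: abs_mult)
  qed (intro summable_mult sm)
  then have sm_n: "summable (\<lambda>n. real n * \<pi> (Suc n))"
    by (rule sums_summable)
  \<comment> \<open>Exit rates grow linearly in the state, so the first moment makes them summable
    against \<pi>.\<close>
  have "summable (\<lambda>n. (lam + \<mu> + \<kappa>) * \<pi> (Suc n) + \<nu> * (real n * \<pi> (Suc n)))"
    by (intro summable_add summable_mult sm_Suc sm_n)
  also have "(\<lambda>n. (lam + \<mu> + \<kappa>) * \<pi> (Suc n) + \<nu> * (real n * \<pi> (Suc n))) =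
      (\<lambda>n. \<pi> (Suc n) * - ?Q (Suc n) (Suc n))"
    unfolding queue_generator_diagonal_Suc by (simp add: algebra_simps)
  finally have "summable (\<lambda>n. \<pi> n * - ?Q n n)"
    using summable_Suc_iff[of "\<lambda>n. \<pi> n * - ?Q n n"] by blast
  note bal = stationary_cut_balance[OF tf st this, unfolded out into]
  have T: "(\<lambda>k. \<pi> (k + Suc n)) sums (\<Sum>k. \<pi> (k + Suc n))" for n
    using sm by (intro summable_sums) (simp only: summable_iff_shift)
  show "cut_balance (lam / \<nu>) (\<kappa> / \<nu>) (\<mu> / \<nu>) \<pi> (\<lambda>n. \<Sum>k. \<pi> (k + Suc n))"
    unfolding cut_balance_def
  proof (intro conjI allI)
    fix n
    have "(\<lambda>k. if k = 0 then (\<mu> + real n * \<nu>) * \<pi> (Suc n) else 0) sums ((\<mu> + real n * \<nu>) * \<pi> (Suc n))"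
      by (rule sums_single)
    from sums_add[OF sums_mult[OF T, of \<kappa> n] this]
    have "(\<lambda>k. \<pi> (k + Suc n) * (\<kappa> + (if k = 0 then \<mu> + real n * \<nu> else 0))) sums
        (\<kappa> * (\<Sum>k. \<pi> (k + Suc n)) + (\<mu> + real n * \<nu>) * \<pi> (Suc n))"
      by (rule sums_cong[THEN iffD1, rotated]) (auto simp: algebra_simps)
    then have "lam * \<pi> n = \<kappa> * (\<Sum>k. \<pi> (k + Suc n)) + (\<mu> + real n * \<nu>) * \<pi> (Suc n)"
      using bal by (rule sums_unique2[symmetric])
    then show "lam / \<nu> * \<pi> n =
        (\<mu> / \<nu> + real n) * \<pi> (Suc n) + \<kappa> / \<nu> * (\<Sum>k. \<pi> (k + Suc n))"
      using pos by (simp add: field_simps)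
    show "(\<Sum>k. \<pi> (k + Suc n)) = (\<Sum>k. \<pi> (k + Suc (Suc n))) + \<pi> (Suc n)"
      using suminf_split_head[OF sums_summable[OF T[of n]]] by simp
  next
    show "(\<lambda>n. \<Sum>k. \<pi> (k + Suc n)) \<longlonglongrightarrow> 0"
      using LIMSEQ_Suc[OF suminf_exist_split2[OF sm]] by simp
  qed
qed

section \<open>Waiting times given the number of customers found\<close>

lemma sets_exponential_law [measurable_cong, simp]: "sets (exponential_law r) = sets borel"
  by (simp add: exponential_law_def)

lemma space_exponential_law [simp]: "space (exponential_law r) = UNIV"
  by (simp add: exponential_law_def)

lemma prob_space_exponential_law: "0 < r \<Longrightarrow> prob_space (exponential_law r)"
  unfolding exponential_law_def by (rule prob_space_exponential_density)

lemma nn_integral_exponential_law: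
  assumes [measurable]: "f \<in> borel_measurable borel"
  shows "(\<integral>\<^sup>+x. f x \<partial>exponential_law r) = (\<integral>\<^sup>+x. ennreal (exponential_density r x) * f x \<partial>lborel)"
  unfolding exponential_law_def by (intro nn_integral_density) auto

lemma AE_exponential_law_nonneg: "AE x in exponential_law r. 0 \<le> x"
  unfolding exponential_law_def by (subst AE_density) (auto simp: exponential_density_def)

lemma has_bochner_integral_exponential_law:
  assumes "0 < r"
  shows "has_bochner_integral (exponential_law r) (\<lambda>x. x) (1 / r)"
proof (rule has_bochner_integral_nn_integral)
  have "(\<integral>\<^sup>+x. ennreal x \<partial>exponential_law r) = (\<integral>\<^sup>+x. ennreal (exponential_density r x * x ^ 1) \<partial>lborel)"
    by (subst nn_integral_exponential_law)
      (use assms in \<open>auto intro!: nn_integral_cong simp: ennreal_mult' exponential_density_nonneg\<close>)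
  then show "(\<integral>\<^sup>+x. ennreal x \<partial>exponential_law r) = ennreal (1 / r)"
    using nn_integral_erlang_ith_moment[OF assms, of 0 1] by simp
qed (use assms AE_exponential_law_nonneg in auto)

text \<open>Tilting the density of rate \<open>r\<close> by \<open>exp (- s * x)\<close> gives
  \<open>r / (r + s)\<close> times the density of rate \<open>r + s\<close>.\<close>

lemma nn_integral_exponential_law_exp:
  assumes "0 < r" "0 \<le> s"
  shows "(\<integral>\<^sup>+x. ennreal (exp (- s * x)) \<partial>exponential_law r) = ennreal (r / (r + s))"
proof -
  have "(\<integral>\<^sup>+x. ennreal (exp (- s * x)) \<partial>exponential_law r) =
      (\<integral>\<^sup>+x. ennreal (r / (r + s)) * ennreal (exponential_density (r + s) x) \<partial>lborel)"
    using assms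
    by (subst nn_integral_exponential_law)
      (auto intro!: nn_integral_cong arg_cong[where f = ennreal]
        simp: exponential_density_def ennreal_mult'[symmetric] divide_simps exp_add[symmetric] algebra_simps)
  also have "\<dots> = ennreal (r / (r + s)) * (\<integral>\<^sup>+x. ennreal (exponential_density (r + s) x) \<partial>lborel)"
    by (rule nn_integral_cmult) simp
  also have "(\<integral>\<^sup>+x. ennreal (exponential_density (r + s) x) \<partial>lborel) = 1"
    using nn_integral_erlang_ith_moment[of "r + s" 0 0] assms by simp
  finally show ?thesis by simp
qed

lemma emeasure_exponential_law_greaterThan:
  assumes "0 < r" "0 \<le> x"
  shows "emeasure (exponential_law r) {x<..} = ennreal (exp (- r * x))"
proof -
  interpret prob_space "exponential_law r"
    by (rule prob_space_exponential_law[OF assms(1)])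
  have "distributed (exponential_law r) lborel (\<lambda>x. x) (exponential_density r)"
    unfolding distributed_def using assms
    by (auto simp: exponential_law_def distr_id2)
  from exponential_distributedD_gt[OF this assms(2,1)]
  show ?thesis
    by (simp add: emeasure_eq_measure greaterThan_def mult.commute)
qed

lemma nn_integral_exp_Icc:
  fixes s v :: real
  assumes "0 < s"
  shows "(\<integral>\<^sup>+x. ennreal (exp (- s * x)) * indicator {0..v} x \<partial>lborel) = ennreal ((1 - exp (- s * v)) / s)"
proof (cases "0 \<le> v")
  case True
  have "(\<integral>\<^sup>+x. ennreal (exp (- s * x)) * indicator {0..v} x \<partial>lborel) =
      ennreal (- exp (- s * v) / s - - exp (- s * 0) / s)"
    using assms True by (intro nn_integral_FTC_Icc) (auto intro!: derivative_eq_intros)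
  also have "- exp (- s * v) / s - - exp (- s * 0) / s = (1 - exp (- s * v)) / s"
    using assms by (simp add: field_simps)
  finally show ?thesis .
next
  case False
  \<comment> \<open>For negative \<open>v\<close> the interval is empty and \<open>ennreal\<close>
    truncates the right-hand side to 0.\<close>
  then have "(1 - exp (- s * v)) / s \<le> 0"
    using assms by (simp add: divide_le_0_iff mult_nonneg_nonpos)
  then show ?thesis
    using False by (simp add: ennreal_neg)
qed

lemma nn_integral_exponential_law_greater:
  assumes "0 < r" "0 \<le> x"
  shows "(\<integral>\<^sup>+y. (if x < y then 1 else 0) \<partial>exponential_law r) = ennreal (exp (- r * x))"
proof -
  have "(\<lambda>y. if x < y then 1 else 0) = (indicator {x<..} :: real \<Rightarrow> ennreal)"
    by (auto simp: indicator_def)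
  then show ?thesis
    by (simp add: emeasure_exponential_law_greaterThan assms)
qed

text \<open>Layer-cake formula; a negative minimum is truncated to 0 on both sides.\<close>

lemma ennreal_min3_eq_nn_integral:
  "ennreal (min v (min a r)) =
     (\<integral>\<^sup>+x. indicator {0..v} x * ((if x < a then 1 else 0) * (if x < r then 1 else 0)) \<partial>lborel)"
proof -
  have "(\<integral>\<^sup>+x. indicator {0..v} x * ((if x < a then 1 else 0) * (if x < r then 1 else 0)) \<partial>lborel) =
      (\<integral>\<^sup>+x. indicator ({0..v} \<inter> {..<min a r}) x \<partial>lborel)"
    by (intro nn_integral_cong) (auto simp: indicator_def)
  also have "\<dots> = emeasure lborel ({0..v} \<inter> {..<min a r})"
    by (rule nn_integral_indicator) auto
  also have "{0..v} \<inter> {..<min a r} = (if v < min a r then {0..v} else {0..<min a r})"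
    by auto
  also have "emeasure lborel \<dots> = ennreal (min v (min a r))"
  proof (cases "v < min a r")
    case True
    then show ?thesis
      by (simp add: emeasure_lborel_Icc_eq ennreal_neg)
  next
    case False
    then show ?thesis
      by (cases "0 \<le> min a r") (auto simp: ennreal_neg min_absorb2)
  qed
  finally show ?thesis ..
qed

text \<open>After the layer-cake formula and Tonelli, level \<open>x\<close> carries the product of
  two survival probabilities, \<open>exp (- (\<alpha> + \<beta>) * x)\<close>, to be integrated over
  \<open>{0..v}\<close>.\<close>

lemma nn_integral_exponential_law_min:
  assumes "0 < \<alpha>" "0 < \<beta>"
  shows "(\<integral>\<^sup>+a. (\<integral>\<^sup>+r. ennreal (min v (min a r)) \<partial>exponential_law \<beta>) \<partial>exponential_law \<alpha>) =
    ennreal ((1 - exp (- (\<alpha> + \<beta>) * v)) / (\<alpha> + \<beta>))"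
proof -
  interpret A: prob_space "exponential_law \<alpha>"
    by (rule prob_space_exponential_law[OF assms(1)])
  interpret B: prob_space "exponential_law \<beta>"
    by (rule prob_space_exponential_law[OF assms(2)])
  interpret LA: pair_sigma_finite lborel "exponential_law \<alpha>" ..
  interpret LB: pair_sigma_finite lborel "exponential_law \<beta>" ..
  have "(\<integral>\<^sup>+r. ennreal (min v (min a r)) \<partial>exponential_law \<beta>) =
      (\<integral>\<^sup>+x. indicator {0..v} x * ((if x < a then 1 else 0) * ennreal (exp (- \<beta> * x))) \<partial>lborel)" for a
  proof -
    have "(\<integral>\<^sup>+r. ennreal (min v (min a r)) \<partial>exponential_law \<beta>) =
        (\<integral>\<^sup>+x. (\<integral>\<^sup>+r. indicator {0..v} x * ((if x < a then 1 else 0) * (if x < r then 1 else 0))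
          \<partial>exponential_law \<beta>) \<partial>lborel)"
      unfolding ennreal_min3_eq_nn_integral by (rule LB.Fubini') measurable
    also have "\<dots> = (\<integral>\<^sup>+x. indicator {0..v} x * ((if x < a then 1 else 0) * ennreal (exp (- \<beta> * x))) \<partial>lborel)"
      by (intro nn_integral_cong)
        (auto simp: nn_integral_cmult nn_integral_exponential_law_greater assms indicator_def[of "{0..v}"])
    finally show ?thesis .
  qed
  then have "(\<integral>\<^sup>+a. (\<integral>\<^sup>+r. ennreal (min v (min a r)) \<partial>exponential_law \<beta>) \<partial>exponential_law \<alpha>) =
      (\<integral>\<^sup>+a. (\<integral>\<^sup>+x. indicator {0..v} x * ((if x < a then 1 else 0) * ennreal (exp (- \<beta> * x))) \<partial>lborel)
        \<partial>exponential_law \<alpha>)"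
    by simp
  also have "\<dots> = (\<integral>\<^sup>+x. (\<integral>\<^sup>+a. indicator {0..v} x * ((if x < a then 1 else 0) * ennreal (exp (- \<beta> * x)))
      \<partial>exponential_law \<alpha>) \<partial>lborel)"
    by (rule LA.Fubini') measurable
  also have "\<dots> = (\<integral>\<^sup>+x. ennreal (exp (- (\<alpha> + \<beta>) * x)) * indicator {0..v} x \<partial>lborel)"
    by (intro nn_integral_cong)
      (auto simp: nn_integral_cmult nn_integral_multc nn_integral_exponential_law_greater assms
        indicator_def[of "{0..v}"] ennreal_mult'[symmetric] exp_add[symmetric] algebra_simps)
  finally show ?thesis
    using assms by (simp only: nn_integral_exp_Icc add_pos_pos)
qed

section \<open>The law of the virtual waiting time: mean and Laplace transform\<close>

lemma sets_virtual_waiting_law [measurable_cong, simp]: "sets (virtual_waiting_law \<mu> \<nu> n) = sets borel"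
  by (simp add: virtual_waiting_law_def)

text \<open>Truncated subtraction makes the rate at the unused index 0 positive, so that the whole
  family consists of probability measures.\<close>

lemma virtual_waiting_law_eq:
  "virtual_waiting_law \<mu> \<nu> n =
     distr (PiM {1..n} (\<lambda>j. exponential_law (\<mu> + real (j - 1) * \<nu>))) borel (\<lambda>z. \<Sum>j\<in>{1..n}. z j)"
  unfolding virtual_waiting_law_def
  by (intro arg_cong2[where f = "\<lambda>M. distr M borel"] PiM_cong refl) (simp add: of_nat_diff)

lemma prod_atLeast1: "(\<Prod>j\<in>{1..n}. f (j - 1)) = (\<Prod>j<n. f j)" for n :: nat
  by (rule prod.reindex_bij_witness[of _ Suc "\<lambda>j. j - 1"]) auto

lemma sum_atLeast1: "(\<Sum>j\<in>{1..n}. f (j - 1)) = (\<Sum>j<n. f j)" for n :: nat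
  by (rule sum.reindex_bij_witness[of _ Suc "\<lambda>j. j - 1"]) auto

context
  fixes \<mu> \<nu> :: real
  assumes pos: "0 < \<mu>" "0 < \<nu>"
begin

private abbreviation "Z \<equiv> \<lambda>j::nat. exponential_law (\<mu> + real (j - 1) * \<nu>)"

private lemma rate_pos: "0 < \<mu> + real m * \<nu>"
  using pos by (simp add: add_pos_nonneg)

private lemma prob_Z: "prob_space (Z j)"
  by (intro prob_space_exponential_law rate_pos)

private lemma sum_measurable:
  "(\<lambda>z. \<Sum>j\<in>{1..n}. z j) \<in> borel_measurable (PiM {1..n} Z)"
  by (intro borel_measurable_sum) measurable

lemma prob_space_virtual_waiting_law: "prob_space (virtual_waiting_law \<mu> \<nu> n)"
  unfolding virtual_waiting_law_eq
  by (intro prob_space.prob_space_distr prob_space_PiM prob_Z sum_measurable)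

lemma AE_virtual_waiting_law_nonneg: "AE v in virtual_waiting_law \<mu> \<nu> n. 0 \<le> v"
proof -
  have "AE z in PiM {1..n} Z. \<forall>j\<in>{1..n}. 0 \<le> z j"
    by (intro AE_finite_allI AE_PiM_component prob_Z AE_exponential_law_nonneg) auto
  then have "AE z in PiM {1..n} Z. 0 \<le> (\<Sum>j\<in>{1..n}. z j)"
    by eventually_elim (auto intro: sum_nonneg)
  then show ?thesis
    unfolding virtual_waiting_law_eq by (subst AE_distr_iff[OF sum_measurable]) auto
qed

lemma has_bochner_integral_virtual_waiting_law:
  "has_bochner_integral (virtual_waiting_law \<mu> \<nu> n) (\<lambda>v. v) (\<Sum>j<n. 1 / (\<mu> + real j * \<nu>))"
proof -
  have "has_bochner_integral (PiM {1..n} Z) (\<lambda>z. z j) (1 / (\<mu> + real (j - 1) * \<nu>))" if "j \<in> {1..n}" for j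
  proof -
    have "has_bochner_integral (distr (PiM {1..n} Z) (Z j) (\<lambda>z. z j)) (\<lambda>x. x) (1 / (\<mu> + real (j - 1) * \<nu>))"
      by (subst distr_PiM_component[OF prob_Z that])
        (intro has_bochner_integral_exponential_law rate_pos)
    then show ?thesis
      using that by (simp add: has_bochner_integral_iff integrable_distr_eq integral_distr)
  qed
  then have "has_bochner_integral (PiM {1..n} Z) (\<lambda>z. \<Sum>j\<in>{1..n}. z j)
      (\<Sum>j\<in>{1..n}. 1 / (\<mu> + real (j - 1) * \<nu>))"
    by (rule has_bochner_integral_sum)
  then show ?thesis
    unfolding virtual_waiting_law_eq sum_atLeast1[of "\<lambda>j. 1 / (\<mu> + real j * \<nu>)"]
    by (intro has_bochner_integral_distr sum_measurable) auto
qed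

lemma has_bochner_integral_virtual_waiting_law_exp:
  assumes "0 \<le> s"
  shows "has_bochner_integral (virtual_waiting_law \<mu> \<nu> n) (\<lambda>v. exp (- s * v))
    (\<Prod>j<n. (\<mu> + real j * \<nu>) / (\<mu> + real j * \<nu> + s))"
proof (rule has_bochner_integral_nn_integral)
  interpret product_prob_space Z "{1..n}"
    by (rule product_prob_spaceI[OF prob_Z])
  have "(\<integral>\<^sup>+v. ennreal (exp (- s * v)) \<partial>virtual_waiting_law \<mu> \<nu> n) =
      (\<integral>\<^sup>+z. (\<Prod>j\<in>{1..n}. ennreal (exp (- s * z j))) \<partial>PiM {1..n} Z)"
    unfolding virtual_waiting_law_eq
    by (subst nn_integral_distr[OF sum_measurable])
      (auto simp: exp_sum[symmetric] prod_ennreal sum_distrib_left sum_negf)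
  also have "\<dots> = (\<Prod>j\<in>{1..n}. \<integral>\<^sup>+x. ennreal (exp (- s * x)) \<partial>Z j)"
    by (rule product_nn_integral_prod) auto
  also have "\<dots> = (\<Prod>j\<in>{1..n}. ennreal ((\<mu> + real (j - 1) * \<nu>) / (\<mu> + real (j - 1) * \<nu> + s)))"
    by (intro prod.cong refl nn_integral_exponential_law_exp rate_pos assms)
  also have "\<dots> = (\<Prod>j<n. ennreal ((\<mu> + real j * \<nu>) / (\<mu> + real j * \<nu> + s)))"
    by (rule prod_atLeast1)
  also have "\<dots> = ennreal (\<Prod>j<n. (\<mu> + real j * \<nu>) / (\<mu> + real j * \<nu> + s))"
    using rate_pos assms by (intro prod_ennreal divide_nonneg_nonneg) (auto intro: less_imp_le add_nonneg_nonneg)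
  finally show "(\<integral>\<^sup>+v. ennreal (exp (- s * v)) \<partial>virtual_waiting_law \<mu> \<nu> n) =
      ennreal (\<Prod>j<n. (\<mu> + real j * \<nu>) / (\<mu> + real j * \<nu> + s))" .
  show "0 \<le> (\<Prod>j<n. (\<mu> + real j * \<nu>) / (\<mu> + real j * \<nu> + s))"
    using rate_pos assms by (intro prod_nonneg divide_nonneg_nonneg) (auto intro: less_imp_le add_nonneg_nonneg)
qed auto

text \<open>For \<open>v \<ge> 0\<close> the integrand is the mean of the minimum of
  \<open>v\<close> and an exponential time of rate \<open>s\<close>; averaging it needs only the
  Laplace transform.\<close>

lemma nn_integral_virtual_waiting_law_decay:
  assumes "0 < s"
  shows "(\<integral>\<^sup>+v. ennreal ((1 - exp (- s * v)) / s) \<partial>virtual_waiting_law \<mu> \<nu> n) =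
    ennreal ((1 - (\<Prod>j<n. (\<mu> + real j * \<nu>) / (\<mu> + real j * \<nu> + s))) / s)"
proof -
  interpret prob_space "virtual_waiting_law \<mu> \<nu> n"
    by (rule prob_space_virtual_waiting_law)
  have "has_bochner_integral (virtual_waiting_law \<mu> \<nu> n) (\<lambda>_. 1) (1 :: real)"
    by (simp add: has_bochner_integral_iff prob_space)
  from has_bochner_integral_divide_zero[OF has_bochner_integral_diff[OF this
      has_bochner_integral_virtual_waiting_law_exp[of s n]], of s]
  have *: "has_bochner_integral (virtual_waiting_law \<mu> \<nu> n) (\<lambda>v. (1 - exp (- s * v)) / s)
      ((1 - (\<Prod>j<n. (\<mu> + real j * \<nu>) / (\<mu> + real j * \<nu> + s))) / s)"
    using assms by simp
  have "AE v in virtual_waiting_law \<mu> \<nu> n. 0 \<le> (1 - exp (- s * v)) / s"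
    using AE_virtual_waiting_law_nonneg by eventually_elim (use assms in auto)
  with * show ?thesis
    by (auto simp: has_bochner_integral_iff nn_integral_eq_integral)
qed

section \<open>Conditional means of the waiting times and mixing over the number found\<close>

context
  fixes \<kappa> :: real
  assumes \<kappa>: "0 < \<kappa>"
begin

private abbreviation "K n \<equiv> virtual_waiting_law \<mu> \<nu> n \<Otimes>\<^sub>M (exponential_law \<nu> \<Otimes>\<^sub>M exponential_law \<kappa>)"

private lemma nn_integral_K:
  assumes [measurable]: "f \<in> borel_measurable (borel \<Otimes>\<^sub>M (borel \<Otimes>\<^sub>M borel))"
  shows "(\<integral>\<^sup>+z. f z \<partial>K n) =
    (\<integral>\<^sup>+v. (\<integral>\<^sup>+a. (\<integral>\<^sup>+r. f (v, a, r) \<partial>exponential_law \<kappa>) \<partial>exponential_law \<nu>) \<partial>virtual_waiting_law \<mu> \<nu> n)"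
proof -
  interpret A: prob_space "exponential_law \<nu>"
    by (rule prob_space_exponential_law[OF pos(2)])
  interpret R: prob_space "exponential_law \<kappa>"
    by (rule prob_space_exponential_law[OF \<kappa>])
  interpret AR: pair_prob_space "exponential_law \<nu>" "exponential_law \<kappa>" ..
  have "(\<integral>\<^sup>+z. f z \<partial>K n) =
      (\<integral>\<^sup>+v. (\<integral>\<^sup>+p. f (v, p) \<partial>(exponential_law \<nu> \<Otimes>\<^sub>M exponential_law \<kappa>)) \<partial>virtual_waiting_law \<mu> \<nu> n)"
    by (rule AR.nn_integral_fst[symmetric]) measurable
  also have "\<dots> = (\<integral>\<^sup>+v. (\<integral>\<^sup>+a. (\<integral>\<^sup>+r. f (v, a, r) \<partial>exponential_law \<kappa>) \<partial>exponential_law \<nu>) \<partial>virtual_waiting_law \<mu> \<nu> n)"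
    by (intro nn_integral_cong R.nn_integral_fst[symmetric]) measurable
  finally show ?thesis .
qed

lemma nn_integral_virtual_waiting_time:
  "(\<integral>\<^sup>+(v, a, r). ennreal v \<partial>K n) = ennreal (\<Sum>j<n. 1 / (\<mu> + real j * \<nu>))"
proof -
  interpret A: prob_space "exponential_law \<nu>"
    by (rule prob_space_exponential_law[OF pos(2)])
  interpret R: prob_space "exponential_law \<kappa>"
    by (rule prob_space_exponential_law[OF \<kappa>])
  have "(\<integral>\<^sup>+(v, a, r). ennreal v \<partial>K n) = (\<integral>\<^sup>+v. ennreal v \<partial>virtual_waiting_law \<mu> \<nu> n)"
    by (subst nn_integral_K) (auto simp: A.emeasure_space_1[simplified] R.emeasure_space_1[simplified])
  also have "\<dots> = ennreal (\<Sum>j<n. 1 / (\<mu> + real j * \<nu>))"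
    using has_bochner_integral_virtual_waiting_law[of n] AE_virtual_waiting_law_nonneg[of n]
    by (auto simp: has_bochner_integral_iff nn_integral_eq_integral)
  finally show ?thesis .
qed

lemma nn_integral_actual_waiting_time:
  "(\<integral>\<^sup>+(v, a, r). ennreal (min v (min a r)) \<partial>K n) =
    ennreal ((1 - (\<Prod>j<n. (\<mu> + real j * \<nu>) / (\<mu> + real j * \<nu> + (\<nu> + \<kappa>)))) / (\<nu> + \<kappa>))"
proof -
  have "(\<integral>\<^sup>+(v, a, r). ennreal (min v (min a r)) \<partial>K n) =
      (\<integral>\<^sup>+v. (\<integral>\<^sup>+a. (\<integral>\<^sup>+r. ennreal (min v (min a r)) \<partial>exponential_law \<kappa>) \<partial>exponential_law \<nu>)
        \<partial>virtual_waiting_law \<mu> \<nu> n)"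
    by (subst nn_integral_K) auto
  then show ?thesis
    using pos \<kappa> by (simp only: nn_integral_exponential_law_min nn_integral_virtual_waiting_law_decay add_pos_pos)
qed

text \<open>The exceptional event is null because its indicator integrates to 0, one coordinate at a
  time.\<close>

lemma AE_waiting_nonneg: "AE (v, a, r) in K n. 0 \<le> v \<and> 0 \<le> min v (min a r)"
proof -
  have "(\<integral>\<^sup>+z. indicator {(v, a, r). \<not> (0 \<le> v \<and> 0 \<le> min v (min a r))} z \<partial>K n) =
      (\<integral>\<^sup>+v. (\<integral>\<^sup>+a. (\<integral>\<^sup>+r. indicator {(v, a, r). \<not> (0 \<le> v \<and> 0 \<le> min v (min a r))} (v, a, r)
        \<partial>exponential_law \<kappa>) \<partial>exponential_law \<nu>) \<partial>virtual_waiting_law \<mu> \<nu> n)"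
    by (rule nn_integral_K) measurable
  also have "\<dots> = 0"
  proof (rule nn_integral_zero')
    show "AE v in virtual_waiting_law \<mu> \<nu> n. (\<integral>\<^sup>+a. (\<integral>\<^sup>+r.
        indicator {(v, a, r). \<not> (0 \<le> v \<and> 0 \<le> min v (min a r))} (v, a, r)
        \<partial>exponential_law \<kappa>) \<partial>exponential_law \<nu>) = (0 :: ennreal)"
      using AE_virtual_waiting_law_nonneg
    proof eventually_elim
      case v: (elim v)
      show ?case
      proof (rule nn_integral_zero')
        show "AE a in exponential_law \<nu>. (\<integral>\<^sup>+r.
            indicator {(v, a, r). \<not> (0 \<le> v \<and> 0 \<le> min v (min a r))} (v, a, r)
            \<partial>exponential_law \<kappa>) = (0 :: ennreal)"
          using AE_exponential_law_nonneg
        proof eventually_elim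
          case a: (elim a)
          have "AE r in exponential_law \<kappa>.
              indicator {(v, a, r). \<not> (0 \<le> v \<and> 0 \<le> min v (min a r))} (v, a, r) = (0 :: ennreal)"
            using AE_exponential_law_nonneg by eventually_elim (use v a in auto)
          then show ?case
            by (rule nn_integral_zero')
        qed
      qed
    qed
  qed
  finally have "(\<integral>\<^sup>+z. indicator {(v, a, r). \<not> (0 \<le> v \<and> 0 \<le> min v (min a r))} z \<partial>K n) = 0" .
  then have "AE z in K n. indicator {(v, a, r). \<not> (0 \<le> v \<and> 0 \<le> min v (min a r))} z = (0 :: ennreal)"
    by (subst (asm) nn_integral_0_iff_AE) auto
  then show ?thesis
    by eventually_elim (auto simp: indicator_def split: if_splits)
qed

text \<open>Total expectation: the sample space is cut into the events \<open>N = n\<close>, and on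
  each of positive probability the conditional law is transported to \<open>K n\<close>.\<close>

lemma arriving_customer_nn_integral:
  assumes ac: "arriving_customer \<mu> \<nu> \<kappa> \<pi> M N V A R"
    and f[measurable]: "f \<in> borel_measurable (borel \<Otimes>\<^sub>M (borel \<Otimes>\<^sub>M borel))"
  shows "(\<integral>\<^sup>+\<omega>. f (V \<omega>, A \<omega>, R \<omega>) \<partial>M) = (\<Sum>n. ennreal (\<pi> n) * (\<integral>\<^sup>+z. f z \<partial>K n))"
proof -
  interpret prob_space M
    using ac by (simp add: arriving_customer_def)
  have meas[measurable]: "N \<in> M \<rightarrow>\<^sub>M count_space UNIV" "V \<in> borel_measurable M"
      "A \<in> borel_measurable M" "R \<in> borel_measurable M"
    and \<pi>: "measure M {\<omega> \<in> space M. N \<omega> = n} = \<pi> n"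
    and law: "0 < \<pi> n \<Longrightarrow>
        distr (uniform_measure M {\<omega> \<in> space M. N \<omega> = n}) (borel \<Otimes>\<^sub>M (borel \<Otimes>\<^sub>M borel))
          (\<lambda>\<omega>. (V \<omega>, A \<omega>, R \<omega>)) = K n" for n
    using ac unfolding arriving_customer_def by blast+
  define S where "S n = {\<omega> \<in> space M. N \<omega> = n}" for n
  have [measurable]: "S n \<in> sets M" for n
    unfolding S_def by measurable
  let ?g = "\<lambda>\<omega>. f (V \<omega>, A \<omega>, R \<omega>)"
  have piece: "(\<integral>\<^sup>+\<omega>. ?g \<omega> * indicator (S n) \<omega> \<partial>M) = ennreal (\<pi> n) * (\<integral>\<^sup>+z. f z \<partial>K n)" for n
  proof (cases "0 < \<pi> n")
    case True
    have S: "emeasure M (S n) = ennreal (\<pi> n)"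
      using \<pi> by (simp add: emeasure_eq_measure S_def)
    have "(\<integral>\<^sup>+z. f z \<partial>K n) = (\<integral>\<^sup>+\<omega>. ?g \<omega> \<partial>uniform_measure M (S n))"
      unfolding law[OF True, symmetric] S_def[symmetric] by (rule nn_integral_distr) measurable
    also have "\<dots> = (\<integral>\<^sup>+\<omega>. ?g \<omega> * indicator (S n) \<omega> \<partial>M) / ennreal (\<pi> n)"
      unfolding S[symmetric] by (rule nn_integral_uniform_measure) measurable
    finally show ?thesis
      using True mult_divide_eq_ennreal[of "ennreal (\<pi> n)" "\<integral>\<^sup>+\<omega>. ?g \<omega> * indicator (S n) \<omega> \<partial>M"]
      by (simp only: ennreal_times_divide mult.commute[of "ennreal (\<pi> n)"]) simp
  next
    \<comment> \<open>No conditional law is prescribed here, but the event is null and both sides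
      are 0.\<close>
    case False
    then have \<pi>0: "\<pi> n = 0"
      using \<pi>[of n] measure_nonneg[of M "{\<omega> \<in> space M. N \<omega> = n}"] by linarith
    then have "S n \<in> null_sets M"
      using \<pi>[of n] by (auto simp: null_sets_def emeasure_eq_measure S_def)
    then show ?thesis
      using nn_integral_null_set[of "S n" M ?g] \<pi>0 by simp
  qed
  have "(\<integral>\<^sup>+\<omega>. ?g \<omega> \<partial>M) = (\<integral>\<^sup>+\<omega>. (\<Sum>n. ?g \<omega> * indicator (S n) \<omega>) \<partial>M)"
  proof (rule nn_integral_cong)
    fix \<omega> assume "\<omega> \<in> space M"
    then have "(\<Sum>n. ?g \<omega> * indicator (S n) \<omega>) = (\<Sum>n\<in>{N \<omega>}. ?g \<omega> * indicator (S n) \<omega>)"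
      by (intro suminf_finite) (auto simp: S_def)
    then show "?g \<omega> = (\<Sum>n. ?g \<omega> * indicator (S n) \<omega>)"
      using \<open>\<omega> \<in> space M\<close> by (simp add: S_def)
  qed
  also have "\<dots> = (\<Sum>n. \<integral>\<^sup>+\<omega>. ?g \<omega> * indicator (S n) \<omega> \<partial>M)"
    by (rule nn_integral_suminf) measurable
  finally show ?thesis
    unfolding piece .
qed

lemma arriving_customer_has_bochner_integral:
  fixes f :: "real \<times> real \<times> real \<Rightarrow> real"
  assumes ac: "arriving_customer \<mu> \<nu> \<kappa> \<pi> M N V A R"
    and f[measurable]: "f \<in> borel_measurable (borel \<Otimes>\<^sub>M (borel \<Otimes>\<^sub>M borel))"
    and nonneg: "\<And>n. AE z in K n. 0 \<le> f z"
    and w: "\<And>n. (\<integral>\<^sup>+z. ennreal (f z) \<partial>K n) = ennreal (w n)" "\<And>n. 0 \<le> w n"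
    and \<pi>: "\<And>n. 0 \<le> \<pi> n"
    and sums: "(\<lambda>n. \<pi> n * w n) sums x"
  shows "has_bochner_integral M (\<lambda>\<omega>. f (V \<omega>, A \<omega>, R \<omega>)) x"
proof (rule has_bochner_integral_nn_integral)
  have [measurable]: "V \<in> borel_measurable M" "A \<in> borel_measurable M" "R \<in> borel_measurable M"
    using ac unfolding arriving_customer_def by blast+
  show "(\<lambda>\<omega>. f (V \<omega>, A \<omega>, R \<omega>)) \<in> borel_measurable M"
    by measurable
  show "0 \<le> x"
    by (rule sums_le[OF _ sums_zero sums]) (intro mult_nonneg_nonneg \<pi> w(2))
  show "(\<integral>\<^sup>+\<omega>. ennreal (f (V \<omega>, A \<omega>, R \<omega>)) \<partial>M) = ennreal x"
    using arriving_customer_nn_integral[OF ac, of "\<lambda>z. ennreal (f z)"]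
    by (simp add: w ennreal_mult[symmetric] \<pi> suminf_ennreal_eq[OF _ sums] sums_unique[OF sums, symmetric])
  \<comment> \<open>Almost sure nonnegativity passes from the conditional laws to \<open>M\<close>
    by total expectation of the indicator of \<open>f < 0\<close>.\<close>
  have "(\<integral>\<^sup>+z. (if f z < 0 then 1 else 0) \<partial>K n) = 0" for n
  proof (rule nn_integral_zero')
    show "AE z in K n. (if f z < 0 then 1 else 0) = (0 :: ennreal)"
      using nonneg[of n] by eventually_elim auto
  qed
  then have "(\<integral>\<^sup>+\<omega>. (if f (V \<omega>, A \<omega>, R \<omega>) < 0 then 1 else 0) \<partial>M) = 0"
    by (subst arriving_customer_nn_integral[OF ac, of "\<lambda>z. if f z < 0 then 1 else 0"]) auto
  then have "AE \<omega> in M. (if f (V \<omega>, A \<omega>, R \<omega>) < 0 then 1 else 0) = (0 :: ennreal)"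
    by (subst (asm) nn_integral_0_iff_AE) auto
  then show "AE \<omega> in M. 0 \<le> f (V \<omega>, A \<omega>, R \<omega>)"
    by eventually_elim (auto split: if_splits)
qed

end

end

section \<open>Performance measures\<close>

text \<open>The balance equation is multiplied by \<open>u n\<close>, solved for the tail term and
  summed.\<close>

lemma cut_balance_sums:
  assumes "0 < \<gamma>" and bal: "cut_balance \<theta> \<gamma> \<eta> p T"
    and out: "(\<lambda>n. p n * u n) sums X" and into: "(\<lambda>n. (\<eta> + real n) * p (Suc n) * u n) sums Y"
  shows "(\<lambda>n. u n * T n) sums ((\<theta> * X - Y) / \<gamma>)"
proof -
  have "(\<lambda>n. (\<theta> * (p n * u n) - (\<eta> + real n) * p (Suc n) * u n) / \<gamma>) sums ((\<theta> * X - Y) / \<gamma>)"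
    by (intro sums_divide sums_diff sums_mult out into)
  also have "(\<lambda>n. (\<theta> * (p n * u n) - (\<eta> + real n) * p (Suc n) * u n) / \<gamma>) = (\<lambda>n. u n * T n)"
  proof
    fix n
    have "\<theta> * (p n * u n) = u n * (\<theta> * p n)"
      by simp
    also have "\<dots> = u n * ((\<eta> + real n) * p (Suc n) + \<gamma> * T n)"
      by (simp only: cut_balanceD(1)[OF bal, of n])
    finally show "(\<theta> * (p n * u n) - (\<eta> + real n) * p (Suc n) * u n) / \<gamma> = u n * T n"
      using assms(1) by (simp add: field_simps)
  qed
  finally show ?thesis .
qed

text \<open>The tails are summed by exchanging the order of summation; \<open>into\<close> is only needed for
  convergence and \<open>Y\<close> cancels.\<close>

lemma cut_balance_weighted:
  assumes "0 < \<gamma>" "0 < \<eta>" and bal: "cut_balance \<theta> \<gamma> \<eta> p T"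
    and nonneg: "\<And>n. 0 \<le> p n" "\<And>n. 0 \<le> u n"
    and tail: "\<And>n. (\<lambda>k. p (k + Suc n)) sums T n"
    and out: "(\<lambda>n. p n * u n) sums X" and into: "(\<lambda>n. (\<eta> + real n) * p (Suc n) * u n) sums Y"
  shows "(\<lambda>n. p (Suc n) * ((\<eta> + real n) * u n + \<gamma> * (\<Sum>j\<le>n. u j))) sums (\<theta> * X)"
proof -
  have "(\<lambda>n. p n * (\<Sum>j<n. u j)) sums ((\<theta> * X - Y) / \<gamma>)"
    by (intro sums_tail_weighted[OF nonneg tail] cut_balance_sums[OF assms(1) bal out into])
  then have "(\<lambda>n. p (Suc n) * (\<Sum>j\<le>n. u j)) sums ((\<theta> * X - Y) / \<gamma>)"
    using sums_Suc_iff[of "\<lambda>n. p n * (\<Sum>j<n. u j)"] by (simp add: lessThan_Suc_atMost)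
  from sums_add[OF into sums_mult[OF this, of \<gamma>]]
  have "(\<lambda>n. p (Suc n) * ((\<eta> + real n) * u n + \<gamma> * (\<Sum>j\<le>n. u j))) sums
      (Y + \<gamma> * ((\<theta> * X - Y) / \<gamma>))"
    by (simp only: distrib_left mult_ac)
  then show ?thesis
    using assms(1) by simp
qed

text \<open>With the constant test sequence 1 the bracket of \<open>cut_balance_weighted\<close> is
  \<open>(\<eta> + \<gamma>) + (\<gamma> + 1) * n\<close>, which isolates the mean.\<close>

lemma cut_balance_mean:
  assumes "0 < \<gamma>" "0 < \<eta>" and bal: "cut_balance \<theta> \<gamma> \<eta> p T"
    and nonneg: "\<And>n. 0 \<le> p n"
    and tail: "\<And>n. (\<lambda>k. p (k + Suc n)) sums T n"
    and total: "p sums 1" and mean: "(\<lambda>n. real n * p (Suc n)) sums L"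
  shows "(\<gamma> + 1) * L = \<theta> - (\<eta> + \<gamma>) * (1 - p 0)"
proof -
  have p_Suc: "(\<lambda>n. p (Suc n)) sums (1 - p 0)"
    using total by (subst sums_Suc_iff) simp
  have into: "(\<lambda>n. (\<eta> + real n) * p (Suc n) * 1) sums (\<eta> * (1 - p 0) + L)"
    using sums_add[OF sums_mult[OF p_Suc, of \<eta>] mean] by (simp add: algebra_simps)
  have "(\<lambda>n. p (Suc n) * ((\<eta> + real n) * 1 + \<gamma> * (\<Sum>j\<le>n. 1))) sums (\<theta> * 1)"
    by (rule cut_balance_weighted[OF assms(1,2) bal nonneg _ tail _ into]) (use total in auto)
  moreover have "(\<lambda>n. p (Suc n) * ((\<eta> + real n) * 1 + \<gamma> * (\<Sum>j\<le>n. 1))) sums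
      ((\<eta> + \<gamma>) * (1 - p 0) + (\<gamma> + 1) * L)"
    using sums_add[OF sums_mult[OF p_Suc, of "\<eta> + \<gamma>"] sums_mult[OF mean, of "\<gamma> + 1"]]
    by (simp add: algebra_simps)
  ultimately show ?thesis
    using sums_unique2 by fastforce
qed

text \<open>The product is the Laplace transform of the virtual waiting time at
  \<open>\<nu> + \<kappa>\<close>, with rates in units of \<open>\<nu>\<close>. One minus it is the
  test sequence that makes the bracket of \<open>cut_balance_weighted\<close> exactly
  \<open>(\<gamma> + 1) * n\<close>, so the weighted sum reduces to \<open>L\<close>.\<close>

lemma cut_balance_survival:
  assumes "0 < \<gamma>" "0 < \<eta>" "0 < \<theta>" and bal: "cut_balance \<theta> \<gamma> \<eta> p T"
    and nonneg: "\<And>n. 0 \<le> p n"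
    and tail: "\<And>n. (\<lambda>k. p (k + Suc n)) sums T n"
    and total: "p sums 1" and mean: "(\<lambda>n. real n * p (Suc n)) sums L"
  shows "(\<lambda>n. p n * (1 - (\<Prod>j<n. (\<eta> + real j) / (\<eta> + real j + (1 + \<gamma>))))) sums ((\<gamma> + 1) / \<theta> * L)"
proof -
  define \<phi> where "\<phi> n = (\<Prod>j<n. (\<eta> + real j) / (\<eta> + real j + (1 + \<gamma>)))" for n
  let ?u = "\<lambda>n. 1 - \<phi> n"
  have \<phi>: "0 \<le> \<phi> n" "\<phi> n \<le> 1" for n
    unfolding \<phi>_def using assms by (auto intro!: prod_nonneg prod_le_1 divide_nonneg_nonneg)
  \<comment> \<open>The recursion \<open>(\<eta> + n + 1 + \<gamma>) * \<phi> (n + 1) = (\<eta> + n)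
    * \<phi> n\<close> cancels all products, and each step adds \<open>\<gamma> + 1\<close>.\<close>
  have ident: "(\<eta> + real n) * ?u n + \<gamma> * (\<Sum>j\<le>n. ?u j) = (\<gamma> + 1) * real n" for n
  proof (induction n)
    case (Suc n)
    have "0 < \<eta> + real n + (1 + \<gamma>)"
      using assms by (simp add: add_pos_nonneg)
    then have "(\<eta> + real (Suc n) + \<gamma>) * \<phi> (Suc n) = (\<eta> + real n) * \<phi> n"
      by (simp add: \<phi>_def field_simps)
    moreover have "(\<eta> + real (Suc n)) * ?u (Suc n) + \<gamma> * (\<Sum>j\<le>Suc n. ?u j) =
        (\<eta> + real (Suc n) + \<gamma>) - (\<eta> + real (Suc n) + \<gamma>) * \<phi> (Suc n) + \<gamma> * (\<Sum>j\<le>n. ?u j)"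
      unfolding sum.atMost_Suc by (simp add: algebra_simps del: of_nat_Suc)
    ultimately have "(\<eta> + real (Suc n)) * ?u (Suc n) + \<gamma> * (\<Sum>j\<le>Suc n. ?u j) =
        (1 + \<gamma>) + ((\<eta> + real n) * ?u n + \<gamma> * (\<Sum>j\<le>n. ?u j))"
      by (simp add: right_diff_distrib)
    then show ?case
      unfolding Suc by (simp add: algebra_simps)
  qed (simp add: \<phi>_def)
  have p_Suc: "(\<lambda>n. p (Suc n)) sums (1 - p 0)"
    using total by (subst sums_Suc_iff) simp
  have "summable (\<lambda>n. p n * ?u n)"
    by (rule summable_comparison_test[OF _ sums_summable[OF total]])
      (use \<phi> nonneg in \<open>auto simp: abs_mult intro!: mult_left_le\<close>)
  then have out: "(\<lambda>n. p n * ?u n) sums (\<Sum>n. p n * ?u n)"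
    by (rule summable_sums)
  have "summable (\<lambda>n. \<eta> * p (Suc n) + real n * p (Suc n))"
    by (intro summable_add summable_mult sums_summable[OF p_Suc] sums_summable[OF mean])
  then have "summable (\<lambda>n. (\<eta> + real n) * p (Suc n) * ?u n)"
    by (rule summable_comparison_test[rotated])
      (use \<phi> nonneg assms(2) in \<open>auto simp: abs_mult distrib_right[symmetric] intro!: mult_left_le\<close>)
  then have into: "(\<lambda>n. (\<eta> + real n) * p (Suc n) * ?u n) sums (\<Sum>n. (\<eta> + real n) * p (Suc n) * ?u n)"
    by (rule summable_sums)
  have "(\<lambda>n. p (Suc n) * ((\<eta> + real n) * ?u n + \<gamma> * (\<Sum>j\<le>n. ?u j))) sums (\<theta> * (\<Sum>n. p n * ?u n))"
    by (rule cut_balance_weighted[OF assms(1,2) bal nonneg _ tail out into]) (use \<phi> in simp)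
  moreover have "(\<lambda>n. p (Suc n) * ((\<eta> + real n) * ?u n + \<gamma> * (\<Sum>j\<le>n. ?u j))) sums ((\<gamma> + 1) * L)"
    unfolding ident using sums_mult[OF mean, of "\<gamma> + 1"] by (simp add: mult_ac)
  ultimately have "\<theta> * (\<Sum>n. p n * ?u n) = (\<gamma> + 1) * L"
    by (rule sums_unique2)
  then have "(\<Sum>n. p n * ?u n) = (\<gamma> + 1) / \<theta> * L"
    using assms(3) by (simp add: field_simps)
  with out show ?thesis
    by (simp add: \<phi>_def)
qed

lemma has_sum_atLeast1:
  fixes f :: "nat \<Rightarrow> real"
  assumes "(\<lambda>n. f (Suc n)) sums s" "\<And>n. 0 \<le> f (Suc n)"
  shows "(f has_sum s) {1..}"
proof -
  have "((f \<circ> Suc) has_sum s) UNIV"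
    unfolding o_def using assms by (intro sums_nonneg_imp_has_sum)
  moreover have "{1..} = range Suc"
    by (auto simp: image_iff Suc_le_eq gr0_conv_Suc)
  ultimately show ?thesis
    by (simp only: has_sum_reindex[OF inj_Suc, symmetric])
qed

lemma A_integral_eq: "A_integral \<theta> \<gamma> \<eta> k = \<gamma> * tilted_beta \<theta> (\<eta> + real k) \<gamma>"
  unfolding A_integral_def tilted_beta_def
  by (subst set_integral_mult_right[symmetric]) (simp add: algebra_simps)

theorem mainTheorem11:
  fixes lam \<mu> \<nu> \<kappa> \<theta> \<gamma> \<eta> :: real
    and P :: "real \<Rightarrow> nat \<Rightarrow> nat \<Rightarrow> real"
    and \<pi> A :: "nat \<Rightarrow> real"
  assumes "lam > 0" and "\<mu> > 0" and "\<nu> > 0" and "\<kappa> > 0"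
    and "\<theta> = lam / \<nu>" and "\<gamma> = \<kappa> / \<nu>" and "\<eta> = \<mu> / \<nu>"
    and "A = A_integral \<theta> \<gamma> \<eta>"
    and "transition_function (queue_generator lam \<mu> \<nu> \<kappa>) P"
    and "stationary_distribution P \<pi>"
  shows "\<pi> 0 = \<gamma> * A 0 / ((\<gamma> + \<theta>) * A 0 - \<theta> * A 1) \<and>
    (\<pi> has_sum (1 - \<pi> 0)) {1..} \<and>
    ((\<lambda>k. real k * \<pi> k) has_sum
       ((\<eta> - 1) / (\<gamma> + 1) * \<pi> 0 + (\<theta> - \<eta> + 1) / (\<gamma> + 1))) UNIV \<and>
    ((\<lambda>k. (real k - 1) * \<pi> k) has_sum
       ((\<gamma> + \<eta>) / (\<gamma> + 1) * \<pi> 0 + (\<theta> - \<eta> - \<gamma>) / (\<gamma> + 1))) {1..} \<and>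
    (\<forall>(M :: 'w measure) N V Pat R. arriving_customer \<mu> \<nu> \<kappa> \<pi> M N V Pat R \<longrightarrow>
       has_bochner_integral M (actual_waiting_time V Pat R)
         (1 / lam * ((\<gamma> + \<eta>) / (\<gamma> + 1) * \<pi> 0 + (\<theta> - \<eta> - \<gamma>) / (\<gamma> + 1))) \<and>
       has_bochner_integral M V
         (1 / \<nu> * (\<theta> * \<gamma> / ((\<gamma> + \<theta>) * A 0 - \<theta> * A 1)) *
          (LBINT t:{0..1}. \<gamma> * (1 - t) powr (\<gamma> - 1) *
             (LBINT s:{0..t}. inverse s *
                (LBINT u:{0..s}. u powr (\<eta> - 1) * exp (- \<theta> * u))))))"
proof -
  note pos = assms(1-4) and tf = assms(9) and st = assms(10)
  have pos': "0 < \<theta>" "0 < \<gamma>" "0 < \<eta>"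
    using assms by auto
  note nonneg = stationary_distributionD(1)[OF st]
  define T where "T n = (\<Sum>k. \<pi> (k + Suc n))" for n
  define L where "L = (\<Sum>n. real n * \<pi> (Suc n))"
  define D where "D = (\<gamma> + \<theta>) * A 0 - \<theta> * A 1"
  define I where "I = (LBINT t:{0..1}. \<gamma> * (1 - t) powr (\<gamma> - 1) *
      (LBINT s:{0..t}. inverse s * (LBINT u:{0..s}. u powr (\<eta> - 1) * exp (- \<theta> * u))))"
  have total: "\<pi> sums 1"
    using stationary_distributionD(2)[OF st] by (rule has_sum_imp_sums)
  have tail: "(\<lambda>k. \<pi> (k + Suc n)) sums T n" for n
    unfolding T_def by (rule summable_sums) (simp only: summable_iff_shift sums_summable[OF total])
  have p_Suc: "(\<lambda>n. \<pi> (Suc n)) sums (1 - \<pi> 0)"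
    using total by (subst sums_Suc_iff) simp
  have bal: "cut_balance \<theta> \<gamma> \<eta> \<pi> T"
    using queue_cut_balance(1)[OF pos tf st] unfolding T_def[abs_def] assms(5-7) .
  have mean: "(\<lambda>n. real n * \<pi> (Suc n)) sums L"
    unfolding L_def by (rule queue_cut_balance(2)[OF pos tf st])
  have L: "L = (\<gamma> + \<eta>) / (\<gamma> + 1) * \<pi> 0 + (\<theta> - \<eta> - \<gamma>) / (\<gamma> + 1)"
  proof -
    have "L * (\<gamma> + 1) = (\<gamma> + \<eta>) * \<pi> 0 + (\<theta> - \<eta> - \<gamma>)"
      using cut_balance_mean[OF pos'(2,3) bal nonneg tail total mean] by (simp add: algebra_simps)
    then have "L = ((\<gamma> + \<eta>) * \<pi> 0 + (\<theta> - \<eta> - \<gamma>)) / (\<gamma> + 1)"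
      using pos' by (simp only: eq_divide_eq) simp
    then show ?thesis
      by (simp add: add_divide_distrib[of "(\<gamma> + \<eta>) * \<pi> 0"])
  qed

  \<comment> \<open>Normalisation and the value of \<open>\<pi> 0\<close>\<close>
  have A: "A k = \<gamma> * tilted_beta \<theta> (\<eta> + real k) \<gamma>" for k
    unfolding assms(8) by (rule A_integral_eq)
  have A0: "0 < A 0"
    unfolding A using pos' by (intro mult_pos_pos tilted_beta_pos) auto
  \<comment> \<open>The explicit solution takes the value \<open>A 0\<close> at 0, so
    \<open>c\<close> is the proportionality factor.\<close>
  define c where "c = \<pi> 0 / A 0"
  have T: "T n = c * (\<theta> ^ Suc n / pochhammer \<eta> n * tilted_beta \<theta> (\<eta> + real n) (\<gamma> + 1))" for n
    using cut_balance_tail_unique[OF pos' bal cut_balance_explicit[OF pos'], of n]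
      tilted_beta_pos[of \<eta> \<gamma> \<theta>] pos'
    by (simp add: c_def A)
  have T0: "T 0 = 1 - \<pi> 0"
    using tail[of 0] p_Suc by (auto intro: sums_unique2)
  have "\<gamma> * tilted_beta \<theta> \<eta> (\<gamma> + 1) = A 0 - A 1"
    using tilted_beta_split[of \<eta> \<gamma> \<theta>] pos' by (simp add: A right_diff_distrib)
  \<comment> \<open>Total mass 1 fixes \<open>T 0\<close>. Equating it with the explicit tail is a
    linear equation that becomes \<open>c * D = \<gamma>\<close> through
    \<open>\<pi> 0 = c * A 0\<close>; it also shows that \<open>D\<close> is nonzero.\<close>
  then have "c * (\<theta> * (A 0 - A 1)) = \<gamma> * (1 - \<pi> 0)"
    unfolding T0[symmetric] T by (simp flip: \<open>\<gamma> * tilted_beta \<theta> \<eta> (\<gamma> + 1) = A 0 - A 1\<close>)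
  then have cD: "c * D = \<gamma>"
    using A0 by (simp add: D_def c_def field_simps)
  then have "D \<noteq> 0"
    using pos' by auto
  with cD have c: "c = \<gamma> / D"
    by (simp add: field_simps)
  then have \<pi>0: "\<pi> 0 = \<gamma> * A 0 / D"
    using A0 by (simp add: c_def field_simps)

  \<comment> \<open>Delay probability and mean lengths\<close>
  have delay: "(\<pi> has_sum (1 - \<pi> 0)) {1..}"
    using p_Suc nonneg by (rule has_sum_atLeast1)
  \<comment> \<open>The mean system length is the mean queue length plus the delay
    probability.\<close>
  have "(\<lambda>k. real (Suc k) * \<pi> (Suc k)) sums (L + (1 - \<pi> 0))"
    using sums_add[OF mean p_Suc] by (simp add: algebra_simps)
  then have "(\<lambda>k. real k * \<pi> k) sums (L + (1 - \<pi> 0))"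
    by (subst (asm) sums_Suc_iff) simp
  moreover have "L + (1 - \<pi> 0) = (\<eta> - 1) / (\<gamma> + 1) * \<pi> 0 + (\<theta> - \<eta> + 1) / (\<gamma> + 1)"
    unfolding L using pos' by (simp add: divide_simps) (simp add: algebra_simps)
  ultimately have system: "((\<lambda>k. real k * \<pi> k) has_sum
      ((\<eta> - 1) / (\<gamma> + 1) * \<pi> 0 + (\<theta> - \<eta> + 1) / (\<gamma> + 1))) UNIV"
    using nonneg by (intro sums_nonneg_imp_has_sum) auto
  have queue: "((\<lambda>k. (real k - 1) * \<pi> k) has_sum L) {1..}"
    using mean nonneg by (intro has_sum_atLeast1) auto

  \<comment> \<open>Mean actual waiting time\<close>
  define w where "w n = (1 - (\<Prod>j<n. (\<mu> + real j * \<nu>) / (\<mu> + real j * \<nu> + (\<nu> + \<kappa>)))) / (\<nu> + \<kappa>)" for n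
  \<comment> \<open>\<open>w n\<close> is the conditional mean of the actual waiting time; dividing
    all rates in the product by \<open>\<nu>\<close> matches
    \<open>cut_balance_survival\<close>.\<close>
  have w_eq: "w n = (1 - (\<Prod>j<n. (\<eta> + real j) / (\<eta> + real j + (1 + \<gamma>)))) / (\<nu> + \<kappa>)" for n
  proof -
    have "(\<mu> + real j * \<nu>) / (\<mu> + real j * \<nu> + (\<nu> + \<kappa>)) = (\<eta> + real j) / (\<eta> + real j + (1 + \<gamma>))" for j
    proof -
      have "\<mu> + real j * \<nu> = \<nu> * (\<eta> + real j)" "\<nu> + \<kappa> = \<nu> * (1 + \<gamma>)"
        using assms(3,6,7) by (auto simp: field_simps)
      then have "(\<mu> + real j * \<nu>) / (\<mu> + real j * \<nu> + (\<nu> + \<kappa>)) =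
          (\<nu> * (\<eta> + real j)) / (\<nu> * (\<eta> + real j + (1 + \<gamma>)))"
        by (simp only: distrib_left)
      then show ?thesis
        using assms(3) by simp
    qed
    then show ?thesis
      by (simp add: w_def)
  qed
  have w_nonneg: "0 \<le> w n" for n
    unfolding w_eq using pos pos'
    by (intro divide_nonneg_nonneg diff_ge_0_iff_ge[THEN iffD2] prod_le_1) auto
  have "(\<lambda>n. \<pi> n * w n) sums ((\<gamma> + 1) / \<theta> * L / (\<nu> + \<kappa>))"
    unfolding w_eq times_divide_eq_right
    by (intro sums_divide cut_balance_survival[OF pos'(2,3,1) bal nonneg tail total mean])
  \<comment> \<open>This is Little's law for the queue:
    \<open>\<nu> + \<kappa> = \<nu> * (\<gamma> + 1)\<close> and
    \<open>\<nu> * \<theta> = lam\<close>.\<close>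
  also have "(\<gamma> + 1) / \<theta> * L / (\<nu> + \<kappa>) = 1 / lam * L"
  proof -
    have "\<gamma> + 1 = (\<nu> + \<kappa>) / \<nu>" "\<nu> + \<kappa> \<noteq> 0"
      using pos assms(6) by (auto simp: field_simps)
    then show ?thesis
      using pos assms(5) by simp
  qed
  finally have w_sums: "(\<lambda>n. \<pi> n * w n) sums (1 / lam * L)" .

  \<comment> \<open>Mean virtual waiting time as a series of tails\<close>
  have "(\<lambda>j. c * \<theta> / \<nu> * (\<theta> ^ j / pochhammer \<eta> (Suc j) * tilted_beta \<theta> (\<eta> + real j) (\<gamma> + 1))) sums
      (c * \<theta> / \<nu> * I)"
    using iterated_integral_sums[OF pos'(1,3,2)] unfolding lower_gamma_def I_def by (rule sums_mult)
  \<comment> \<open>Dividing \<open>T j\<close> by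
    \<open>\<mu> + real j * \<nu> = \<nu> * (\<eta> + real j)\<close> raises the index of the
    Pochhammer symbol by one.\<close>
  also have "(\<lambda>j. c * \<theta> / \<nu> * (\<theta> ^ j / pochhammer \<eta> (Suc j) * tilted_beta \<theta> (\<eta> + real j) (\<gamma> + 1))) =
      (\<lambda>j. 1 / (\<mu> + real j * \<nu>) * T j)"
  proof
    fix j
    have "\<mu> + real j * \<nu> = \<nu> * (\<eta> + real j)"
      using assms(3,7) by (simp add: field_simps)
    then show "c * \<theta> / \<nu> * (\<theta> ^ j / pochhammer \<eta> (Suc j) * tilted_beta \<theta> (\<eta> + real j) (\<gamma> + 1)) =
        1 / (\<mu> + real j * \<nu>) * T j"
      unfolding T by (simp add: pochhammer_Suc mult_ac)
  qed
  finally have "(\<lambda>n. \<pi> n * (\<Sum>j<n. 1 / (\<mu> + real j * \<nu>))) sums (c * \<theta> / \<nu> * I)"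
    using pos by (intro sums_tail_weighted[OF nonneg _ tail]) auto
  moreover have "c * \<theta> / \<nu> * I = 1 / \<nu> * (\<theta> * \<gamma> / D) * I"
    by (simp add: c mult_ac)
  ultimately have v_sums: "(\<lambda>n. \<pi> n * (\<Sum>j<n. 1 / (\<mu> + real j * \<nu>))) sums (1 / \<nu> * (\<theta> * \<gamma> / D) * I)"
    by simp

  \<comment> \<open>Transfer of both means to the arriving customer\<close>
  have waiting: "has_bochner_integral M (actual_waiting_time V Pat R) (1 / lam * L) \<and>
      has_bochner_integral M V (1 / \<nu> * (\<theta> * \<gamma> / D) * I)"
    if ac: "arriving_customer \<mu> \<nu> \<kappa> \<pi> M N V Pat R" for M :: "'w measure" and N V Pat R
  proof
    let ?min = "\<lambda>(v, a, r). min v (min a r) :: real"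
    have "has_bochner_integral M (\<lambda>\<omega>. ?min (V \<omega>, Pat \<omega>, R \<omega>)) (1 / lam * L)"
    proof (rule arriving_customer_has_bochner_integral[OF pos(2-4) ac _ _ _ w_nonneg nonneg w_sums])
      show "AE z in virtual_waiting_law \<mu> \<nu> n \<Otimes>\<^sub>M (exponential_law \<nu> \<Otimes>\<^sub>M exponential_law \<kappa>). 0 \<le> ?min z" for n
        using AE_waiting_nonneg[OF pos(2-4), of n] by eventually_elim auto
      show "(\<integral>\<^sup>+z. ennreal (?min z) \<partial>(virtual_waiting_law \<mu> \<nu> n \<Otimes>\<^sub>M
          (exponential_law \<nu> \<Otimes>\<^sub>M exponential_law \<kappa>))) = ennreal (w n)" for n
        using nn_integral_actual_waiting_time[OF pos(2-4), of n]
        by (simp add: w_def case_prod_unfold)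
    qed measurable
    then show "has_bochner_integral M (actual_waiting_time V Pat R) (1 / lam * L)"
      by (simp add: actual_waiting_time_def[abs_def])
    have "has_bochner_integral M (\<lambda>\<omega>. fst (V \<omega>, Pat \<omega>, R \<omega>)) (1 / \<nu> * (\<theta> * \<gamma> / D) * I)"
    proof (rule arriving_customer_has_bochner_integral[OF pos(2-4) ac _ _ _ _ nonneg v_sums])
      show "AE z in virtual_waiting_law \<mu> \<nu> n \<Otimes>\<^sub>M (exponential_law \<nu> \<Otimes>\<^sub>M exponential_law \<kappa>). 0 \<le> fst z" for n
        using AE_waiting_nonneg[OF pos(2-4), of n] by eventually_elim auto
      show "(\<integral>\<^sup>+z. ennreal (fst z) \<partial>(virtual_waiting_law \<mu> \<nu> n \<Otimes>\<^sub>M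
          (exponential_law \<nu> \<Otimes>\<^sub>M exponential_law \<kappa>))) = ennreal (\<Sum>j<n. 1 / (\<mu> + real j * \<nu>))" for n
        using nn_integral_virtual_waiting_time[OF pos(2-4), of n]
        by (simp add: case_prod_unfold)
      show "0 \<le> (\<Sum>j<n. 1 / (\<mu> + real j * \<nu>))" for n
        using pos by (intro sum_nonneg) auto
    qed measurable
    then show "has_bochner_integral M V (1 / \<nu> * (\<theta> * \<gamma> / D) * I)"
      by simp
  qed
  show ?thesis
    unfolding D_def[symmetric] I_def[symmetric] L[symmetric]
    using \<pi>0 delay system queue waiting by blast
qed

end
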